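(* Let $F$ be a field, let $A$ be a non-empty finite subset of $\mathbb N$, and let $P=(P_1,\ldots,P_l)$ and $Q=(Q_1,\ldots,Q_k)$ be elements of $\Pi_A$. Then $$ e_P\wedge e_Q=\begin{cases} e_{Q_{I_1}^\circ}\vee\cdots\vee e_{Q_{I_l}^\circ} & \text{if } Q\preceq^\dagger P,\\ 0 & \text{otherwise,}\end{cases} $$ where, in case $Q\preceq^\dagger P$, $(I_1,\ldots,I_l)$ is the set composition of $[k]=\{1,\ldots,k\}$ such that $Q_{I_j}\in\Pi_{P_j}^\dagger$ for all $j\in\{1,\ldots,l\}$. In particular, $e_A\wedge e_Q=e_{Q^\circ}$ if $Q\in\Pi_A^\dagger$, and $e_A\wedge e_Q=0$ otherwise.
   Context: $\mathbb N$ is the set of positive integers. For a finite subset $A$ of $\mathbb N$, a set composition of $A$ is a tuple $P=(P_1,\ldots,P_l)$ of mutually disjoint non-empty subsets of $A$ with union $A$; its length is $\ell(P)=l$; $\Pi_A$ is the set of all set compositions of $A$ ($\Pi_\emptyset$ consists of the empty tuple). $\Pi=\bigcup_A\Pi_A$ over all finite $A\subset\mathbb N$, and $F\Pi=\bigoplus_A F\Pi_A$ is the $F$-vector space with basis $\Pi$. Products on $F\Pi$ (bilinear): for $P=(P_1,\ldots,P_l)\in\Pi_A$, $Q=(Q_1,\ldots,Q_k)\in\Pi_B$, $P\wedge Q=(P_1\cap Q_1,\ldots,P_1\cap Q_k,\ldots,P_l\cap Q_1,\ldots,P_l\cap Q_k)$ with empty sets deleted if $A=B$, and $P\wedge Q=0$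 if $A\ne B$; $P\vee Q=(P_1,\ldots,P_l,Q_1,\ldots,Q_k)$ if $A\cap B=\emptyset$, and $P\vee Q=0$ otherwise. For non-empty finite $B\subset\mathbb N$: $e_B=\sum_{P}(-1)^{\ell(P)-1}P$, the sum over all $P=(P_1,\ldots,P_l)\in\Pi_B$ with $\min B\in P_1$. For $Q=(Q_1,\ldots,Q_k)\in\Pi$: $e_Q=e_{Q_1}\vee\cdots\vee e_{Q_k}$. The map $Q\mapsto e_Q$ is extended linearly to $F\Pi$, i.e. $e_{\sum f_R R}=\sum f_R e_R$. Right-normed Dynkin mapping: with $f\circ g=f\vee g-g\vee f$, the linear map $f\mapsto f^\circ$ on $F\Pi$ is given by $(B)^\circ=(B)$ for tuples of length one and $(Q_1,\ldots,Q_k)^\circ=(Q_1)\circ\big((Q_2,\ldots,Q_k)^\circ\big)$ for $k>1$. For non-empty $B$: $\Pi_B^\dagger=\{(Q_1,\ldots,Q_k)\in\Pi_B\mid \min B\in Q_k\}$. For $Q=(Q_1,\ldots,Q_k)$ and $I=\{i_1<\cdots<i_m\}\subseteq[k]$, $Q_I=(Q_{i_1},\ldots,Q_{i_m})$. For $Q=(Q_1,\ldots,Q_k)$, $P=(P_1,\ldots,P_l)\in\Pi_A$, write $Q\preceq^\dagger P$ if there is a set composition $(I_1,\ldots,I_l)$ of $[k]$ with $Q_{I_j}\in\Pi^\dagger_{P_j}$ for all $j$ (it is then unique). *)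

theory Defs
  imports Main "HOL-Library.Poly_Mapping"
begin

definition set_comps :: "nat set \<Rightarrow> nat set list set" where
  "set_comps A = {P. (\<forall>B\<in>set P. B \<noteq> {}) \<and>
     (\<forall>i<length P. \<forall>j<length P. i \<noteq> j \<longrightarrow> P ! i \<inter> P ! j = {}) \<and> \<Union>(set P) = A}"

text \<open>
  The vector space \<open>F\<Pi>\<close> is the subspace of \<open>'f comp_space\<close> consisting of the elements
  supported on set compositions (of finite sets of positive integers).  All operations below
  are (bi)linear extensions of maps given on basis elements, and they preserve this subspace;
  their values on other lists of sets carry no meaning.  The ground set \<open>A\<close> of \<open>P \<in> \<Pi>\<^sub>A\<close> is
  recovered from \<open>P\<close> as \<open>\<Union>(set P)\<close>.
\<close>

type_synonym 'f comp_space = "nat set list \<Rightarrow>\<^sub>0 'f"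

definition basis :: "nat set list \<Rightarrow> 'f::field comp_space" where
  "basis P = Poly_Mapping.single P 1"

definition scale :: "'f \<Rightarrow> 'f::field comp_space \<Rightarrow> 'f comp_space" where
  "scale c f = Poly_Mapping.map ((*) c) f"

definition lin_ext ::
    "(nat set list \<Rightarrow> 'f comp_space) \<Rightarrow> 'f::field comp_space \<Rightarrow> 'f comp_space" where
  "lin_ext g f = (\<Sum>P\<in>Poly_Mapping.keys f. scale (Poly_Mapping.lookup f P) (g P))"

definition bilin_ext ::
    "(nat set list \<Rightarrow> nat set list \<Rightarrow> 'f comp_space) \<Rightarrow>
     'f::field comp_space \<Rightarrow> 'f comp_space \<Rightarrow> 'f comp_space" where
  "bilin_ext g f h = lin_ext (\<lambda>P. lin_ext (g P) h) f"

definition wedge_basis :: "nat set list \<Rightarrow> nat set list \<Rightarrow> 'f::field comp_space" where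
  "wedge_basis P Q =
     (if \<Union>(set P) = \<Union>(set Q)
      then basis (filter (\<lambda>B. B \<noteq> {}) (concat (map (\<lambda>p. map (\<lambda>q. p \<inter> q) Q) P)))
      else 0)"

definition vee_basis :: "nat set list \<Rightarrow> nat set list \<Rightarrow> 'f::field comp_space" where
  "vee_basis P Q = (if \<Union>(set P) \<inter> \<Union>(set Q) = {} then basis (P @ Q) else 0)"

definition wedge :: "'f::field comp_space \<Rightarrow> 'f comp_space \<Rightarrow> 'f comp_space"
    (infixl \<open>\<curlywedge>\<close> 70) where
  "f \<curlywedge> g = bilin_ext wedge_basis f g"

definition vee :: "'f::field comp_space \<Rightarrow> 'f comp_space \<Rightarrow> 'f comp_space"
    (infixl \<open>\<curlyvee>\<close> 68) where
  "f \<curlyvee> g = bilin_ext vee_basis f g"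

text \<open>The empty tuple is the unit of \<open>\<curlyvee>\<close>, so it serves as the empty iterated product.\<close>

definition vee_list :: "'f::field comp_space list \<Rightarrow> 'f comp_space" where
  "vee_list fs = foldr (\<curlyvee>) fs (basis [])"

definition e_block :: "nat set \<Rightarrow> 'f::field comp_space" where
  "e_block B = (\<Sum>P | P \<in> set_comps B \<and> Min B \<in> hd P. scale ((-1) ^ (length P - 1)) (basis P))"

definition e_comp :: "nat set list \<Rightarrow> 'f::field comp_space" where
  "e_comp Q = vee_list (map e_block Q)"

definition e_lin :: "'f::field comp_space \<Rightarrow> 'f comp_space" where
  "e_lin f = lin_ext e_comp f"

definition bracket :: "'f::field comp_space \<Rightarrow> 'f comp_space \<Rightarrow> 'f comp_space" where
  "bracket f g = f \<curlyvee> g - g \<curlyvee> f"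

text \<open>The Dynkin mapping is specified on non-empty tuples only; the value on \<open>[]\<close> is a dummy.\<close>

fun dynkin_basis :: "nat set list \<Rightarrow> 'f::field comp_space" where
  "dynkin_basis [] = 0"
| "dynkin_basis [B] = basis [B]"
| "dynkin_basis (B # C # Q) = bracket (basis [B]) (dynkin_basis (C # Q))"

definition dynkin :: "'f::field comp_space \<Rightarrow> 'f comp_space" where
  "dynkin f = lin_ext dynkin_basis f"

definition dagger_comps :: "nat set \<Rightarrow> nat set list set" where
  "dagger_comps B = {Q \<in> set_comps B. Min B \<in> last Q}"

text \<open>
  Positions in a tuple of length \<open>k\<close> are numbered from \<open>0\<close>, so \<open>{..<k}\<close> plays the role of
  \<open>[k] = {1, \<dots>, k}\<close>, and the subtuple \<open>Q\<^sub>I\<close> is \<open>nths Q I\<close>.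
\<close>

definition dagger_witness :: "nat set list \<Rightarrow> nat set list \<Rightarrow> nat set list \<Rightarrow> bool" where
  "dagger_witness Q P Is \<longleftrightarrow>
     Is \<in> set_comps {..<length Q} \<and> length Is = length P \<and>
     (\<forall>j<length P. nths Q (Is ! j) \<in> dagger_comps (P ! j))"

definition dagger_le :: "nat set list \<Rightarrow> nat set list \<Rightarrow> bool" (infix \<open>\<preceq>\<^sup>\<dagger>\<close> 50) where
  "Q \<preceq>\<^sup>\<dagger> P \<longleftrightarrow> (\<exists>Is. dagger_witness Q P Is)"

definition dagger_split :: "nat set list \<Rightarrow> nat set list \<Rightarrow> nat set list" where
  "dagger_split Q P = (THE Is. dagger_witness Q P Is)"

text \<open>The witness is unique, so \<open>dagger_split\<close> is well defined.\<close>

lemma dagger_witness_nth: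
  assumes P: "P \<in> set_comps A" and Q: "Q \<in> set_comps A"
    and w: "dagger_witness Q P Is" and j: "j < length P"
  shows "Is ! j = {i. i < length Q \<and> Q ! i \<subseteq> P ! j}"
proof -
  have un: "\<Union>(set Is) = {..<length Q}" and len: "length Is = length P"
    using w by (auto simp: dagger_witness_def set_comps_def)
  have sub: "Q ! i \<subseteq> P ! j'" if "j' < length P" "i \<in> Is ! j'" for i j'
  proof -
    have "Is ! j' \<subseteq> {..<length Q}" using un len that by (metis Union_upper nth_mem)
    hence "i < length Q" using that by auto
    hence "Q ! i \<in> set (nths Q (Is ! j'))" using that by (auto simp: set_nths)
    moreover have "\<Union>(set (nths Q (Is ! j'))) = P ! j'"
      using w that by (auto simp: dagger_witness_def dagger_comps_def set_comps_def)
    ultimately show ?thesis by blast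
  qed
  show ?thesis
  proof (intro set_eqI iffI)
    fix i assume i: "i \<in> Is ! j"
    have "i < length Q" using un len j i by (metis UnionI lessThan_iff nth_mem)
    with sub[OF j i] show "i \<in> {i. i < length Q \<and> Q ! i \<subseteq> P ! j}" by simp
  next
    fix i assume i: "i \<in> {i. i < length Q \<and> Q ! i \<subseteq> P ! j}"
    then obtain j' where j': "j' < length P" "i \<in> Is ! j'"
      using un len by (metis (mono_tags, lifting) UnionE in_set_conv_nth lessThan_iff mem_Collect_eq)
    have "Q ! i \<noteq> {}" using Q i by (auto simp: set_comps_def)
    hence "P ! j \<inter> P ! j' \<noteq> {}" using sub[OF j'] i by blast
    hence "j = j'" using P j j' by (auto simp: set_comps_def)
    thus "i \<in> Is ! j" using j' by simp
  qed
qed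

lemma dagger_split_eqI:
  assumes "P \<in> set_comps A" "Q \<in> set_comps A" "dagger_witness Q P Is"
  shows "dagger_split Q P = Is"
  unfolding dagger_split_def
proof (rule the_equality)
  show "dagger_witness Q P Is" by fact
next
  fix Js assume w: "dagger_witness Q P Js"
  have len: "length Js = length P" "length Is = length P"
    using w assms(3) by (auto simp: dagger_witness_def)
  show "Js = Is"
    using len dagger_witness_nth[OF assms(1,2) w] dagger_witness_nth[OF assms]
    by (intro nth_equalityI) auto
qed

text \<open>The index set of the sum defining \<open>e_block\<close> is finite, so that sum is not degenerate.\<close>

lemma finite_set_comps:
  assumes "finite A" shows "finite (set_comps A)"
proof (rule finite_subset)
  have "set P \<subseteq> Pow A \<and> distinct P" if P: "P \<in> set_comps A" for P
  proof
    show "set P \<subseteq> Pow A" using P by (auto simp: set_comps_def)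
    show "distinct P" unfolding distinct_conv_nth
    proof (intro allI impI)
      fix i j assume *: "i < length P" "j < length P" "i \<noteq> j"
      have "P ! i \<inter> P ! j = {}" "P ! i \<noteq> {}" using P * by (auto simp: set_comps_def)
      thus "P ! i \<noteq> P ! j" by auto
    qed
  qed
  thus "set_comps A \<subseteq> {P. set P \<subseteq> Pow A \<and> distinct P}" by blast
  show "finite {P. set P \<subseteq> Pow A \<and> distinct P}"
    using finite_subset_distinct[of "Pow A"] assms by (simp add: conj_commute)
qed

lemma lookup_scale [simp]: "Poly_Mapping.lookup (scale c f) P = c * Poly_Mapping.lookup f P"
  by (simp add: scale_def Poly_Mapping.map.rep_eq when_def)

lemma lin_ext_basis [simp]: "lin_ext g (basis P) = g P"
  by (rule poly_mapping_eqI) (simp add: lin_ext_def basis_def lookup_sum)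

lemma bilin_ext_basis [simp]: "bilin_ext g (basis P) (basis Q) = g P Q"
  by (simp add: bilin_ext_def)

end

theory Submission
  imports Defs "HOL-Library.Product_Plus"
begin

text \<open>
  Lists of blocks form the free monoid under concatenation, and the ambient space is its monoid
  algebra.  On operands with disjoint ground sets \<open>\<curlyvee>\<close> is the multiplication of this algebra, so
  \<open>e\<^sub>Q\<close> is an honest product of the \<open>e\<close>'s of the blocks of \<open>Q\<close>.  Restricting a list of blocks to
  two disjoint sets \<open>X\<close> and \<open>Y\<close> (intersect every block, drop empty intersections) is a monoid
  homomorphism, hence induces an algebra homomorphism \<open>coprod X Y\<close> into the tensor square.
  
  Two properties of this coproduct split the theorem into independent problems, one for each block
  of \<open>P\<close>.  First, if \<open>R\<close> lives on \<open>X\<close> and \<open>S\<close> on \<open>Y\<close>, then \<open>(R \<curlyvee> S) \<curlywedge> f\<close> is obtained by applying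
  \<open>coprod X Y\<close> to \<open>f\<close>, letting \<open>R\<close> and \<open>S\<close> act on the two tensor legs, and multiplying the results.
  Second, \<open>e_block B\<close> is primitive: \<open>coprod X Y\<close> kills it when \<open>B\<close> meets both \<open>X\<close> and \<open>Y\<close>, and
  leaves it in one leg otherwise (\<open>coprod_e_block\<close>).  Hence \<open>e\<^sub>P \<curlywedge> e\<^sub>Q\<close> vanishes unless every block
  of \<open>Q\<close> lies inside a block of \<open>P\<close>, and then it factors into products \<open>e\<^sub>p \<curlywedge> e\<^sub>R\<close>, where \<open>R\<close> lists
  the blocks of \<open>Q\<close> inside \<open>p\<close> (\<open>act_mult\<close>, \<open>act_e_comp\<close>).
  
  Primitivity and the case of one block both come from the signed sum \<open>inv_block B\<close> of all set
  compositions of \<open>B\<close>, the inverse of the family of one-block compositions under the convolution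
  \<open>(f * g) B = (\<Sum>U\<subseteq>B. f U \<curlyvee> g (B - U))\<close>.  One-block compositions are grouplike, hence so are the
  \<open>inv_block B\<close>.  Moreover \<open>e_block B\<close> is the part of the convolution sum \<open>(\<Sum>U\<subseteq>B. (U) \<curlyvee> inv_block (B - U))\<close>
  with \<open>Min B \<in> U\<close>; under the coproduct, the leg that does not contain \<open>Min B\<close> is a full
  convolution sum and therefore zero.
  
  For one block, the same recursion gives \<open>inv_block A \<curlywedge> e\<^sub>Q = (-1)\<^sup>k e\<^sub>R\<close>, where \<open>k\<close> is the length of
  \<open>Q\<close> and \<open>R\<close> is its reversal.  Consequently \<open>e_block A \<curlywedge> e\<^sub>Q\<close> is the alternating sum, over the sets
  \<open>S\<close> of blocks of \<open>Q\<close> that contain the block of \<open>Min A\<close>, of \<open>e\<close> of the word "blocks in \<open>S\<close> in order,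
  then the other blocks in reverse order".  Moving the last block of \<open>Q\<close> into or out of \<open>S\<close> leaves
  the word unchanged and flips the sign, so the sum is zero unless \<open>Min A\<close> lies in the last block;
  in that case the sum is the expansion of the nested commutators in the Dynkin operator.
\<close>

section \<open>The free algebra on blocks\<close>

text \<open>
  With concatenation as addition of exponents, the convolution product of finitely supported
  functions is the multiplication of the free algebra, and the ring laws come for free.
\<close>

instantiation list :: (type) monoid_add
begin

definition zero_list :: "'a list" where "zero_list = []"

definition plus_list :: "'a list \<Rightarrow> 'a list \<Rightarrow> 'a list" where "plus_list = (@)"

instance by standard (simp_all add: zero_list_def plus_list_def)

end

lemma basis_mult: "basis P * basis Q = (basis (P @ Q) :: 'f::field comp_space)"
  by (simp add: basis_def mult_single plus_list_def)

lemma basis_Nil: "basis [] = (1 :: 'f::field comp_space)"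
  by (simp add: basis_def flip: zero_list_def single_one)

lemma sum_single_keys:
  "(\<Sum>k\<in>Poly_Mapping.keys f. Poly_Mapping.single k (Poly_Mapping.lookup f k)) = f"
  by (rule poly_mapping_eqI) (simp add: lookup_sum lookup_single when_def in_keys_iff)

lemma scalar_commute:
  fixes f :: "'a::monoid_add \<Rightarrow>\<^sub>0 'f::comm_semiring_1"
  shows "Poly_Mapping.single 0 c * f = f * Poly_Mapping.single 0 c"
proof -
  have "Poly_Mapping.single 0 c * (\<Sum>k\<in>Poly_Mapping.keys f. Poly_Mapping.single k (Poly_Mapping.lookup f k))
      = (\<Sum>k\<in>Poly_Mapping.keys f. Poly_Mapping.single k (Poly_Mapping.lookup f k)) * Poly_Mapping.single 0 c"
    by (simp add: sum_distrib_left sum_distrib_right mult_single mult.commute)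
  thus ?thesis by (simp add: sum_single_keys)
qed

text \<open>
  Linear extension of a map from basis elements into any monoid algebra; scalars act as multiples
  of the unit, and the target may be the tensor square as well as the algebra itself.
\<close>

definition lext ::
    "('a \<Rightarrow> 'b::monoid_add \<Rightarrow>\<^sub>0 'f::comm_ring_1) \<Rightarrow> ('a \<Rightarrow>\<^sub>0 'f) \<Rightarrow> 'b \<Rightarrow>\<^sub>0 'f" where
  "lext g f = (\<Sum>k\<in>Poly_Mapping.keys f. Poly_Mapping.single 0 (Poly_Mapping.lookup f k) * g k)"

lemma scale_conv_mult: "scale c f = Poly_Mapping.single 0 c * f"
  by (simp add: scale_def mult_map_scale_conv_mult)

lemma lin_ext_eq_lext: "lin_ext = lext"
  by (intro ext) (simp add: lin_ext_def lext_def scale_conv_mult)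

lemma lext_zero [simp]: "lext g 0 = 0"
  by (simp add: lext_def)

lemma lext_single: "lext g (Poly_Mapping.single k c) = Poly_Mapping.single 0 c * g k"
  by (simp add: lext_def)

lemma lext_add: "lext g (p + q) = lext g p + lext g q"
  unfolding lext_def
  by (rule setsum_keys_plus_distrib[where f = "\<lambda>k c. Poly_Mapping.single 0 c * g k"])
    (simp_all add: single_add algebra_simps)

lemma lext_uminus: "lext g (- p) = - lext g p"
  by (metis add.right_inverse lext_add lext_zero neg_eq_iff_add_eq_0)

lemma lext_sum: "lext g (sum p I) = (\<Sum>i\<in>I. lext g (p i))"
  by (induction I rule: infinite_finite_induct) (simp_all add: lext_add)

lemma lext_sign: "lext g ((-1) ^ n * p) = (-1) ^ n * lext g p"
  by (induction n) (simp_all add: lext_uminus)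

lemma lext_cong:
  "(\<And>k. k \<in> Poly_Mapping.keys p \<Longrightarrow> g k = h k) \<Longrightarrow> lext g p = lext h p"
  by (simp add: lext_def)

lemma lext_basis: "lext g (basis P) = g P"
  by (simp add: basis_def lext_single)

lemma lext_one: "lext g 1 = g 0"
  using lext_single[of g 0 1] by simp

text \<open>
  The hypothesis is restricted to the supports, and the three maps may differ.  This covers ordinary
  algebra homomorphisms and also maps that are multiplicative only on elements with prescribed ground sets.
\<close>

lemma lext_mult:
  fixes p q :: "'a::monoid_add \<Rightarrow>\<^sub>0 'f::comm_ring_1" and g :: "'a \<Rightarrow> 'b::monoid_add \<Rightarrow>\<^sub>0 'f"
  assumes "\<And>a b. a \<in> Poly_Mapping.keys p \<Longrightarrow> b \<in> Poly_Mapping.keys q \<Longrightarrow> g (a + b) = u a * v b"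
  shows "lext g (p * q) = lext u p * lext v q"
proof -
  let ?p = "\<lambda>a. Poly_Mapping.lookup p a" and ?q = "\<lambda>b. Poly_Mapping.lookup q b"
  let ?s = "Poly_Mapping.single"
  have "lext g (p * q) = lext g ((\<Sum>a\<in>Poly_Mapping.keys p. ?s a (?p a)) *
      (\<Sum>b\<in>Poly_Mapping.keys q. ?s b (?q b)))"
    by (simp add: sum_single_keys)
  also have "\<dots> = (\<Sum>a\<in>Poly_Mapping.keys p. \<Sum>b\<in>Poly_Mapping.keys q. ?s 0 (?p a * ?q b) * g (a + b))"
    by (simp add: sum_product lext_sum mult_single lext_single)
  also have "\<dots> = (\<Sum>a\<in>Poly_Mapping.keys p. \<Sum>b\<in>Poly_Mapping.keys q. (?s 0 (?p a) * u a) * (?s 0 (?q b) * v b))"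
  proof (intro sum.cong refl)
    fix a b assume ab: "a \<in> Poly_Mapping.keys p" "b \<in> Poly_Mapping.keys q"
    have "?s 0 (?p a * ?q b) * g (a + b) = ?s 0 (?p a) * (?s 0 (?q b) * u a) * v b"
      by (simp add: assms[OF ab] mult.assoc[symmetric] mult_single)
    thus "?s 0 (?p a * ?q b) * g (a + b) = (?s 0 (?p a) * u a) * (?s 0 (?q b) * v b)"
      by (simp only: scalar_commute[of "?q b" "u a"] mult.assoc)
  qed
  also have "\<dots> = lext u p * lext v q"
    by (simp add: lext_def sum_product)
  finally show ?thesis .
qed

definition push :: "('a \<Rightarrow> 'b::monoid_add) \<Rightarrow> ('a \<Rightarrow>\<^sub>0 'f::comm_ring_1) \<Rightarrow> 'b \<Rightarrow>\<^sub>0 'f" where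
  "push h = lext (\<lambda>k. Poly_Mapping.single (h k) 1)"

lemma push_single: "push h (Poly_Mapping.single k c) = Poly_Mapping.single (h k) c"
  by (simp add: push_def lext_single mult_single)

lemma push_basis: "push h (basis P) = Poly_Mapping.single (h P) 1"
  by (simp add: basis_def push_single)

lemma push_zero [simp]: "push h 0 = 0"
  by (simp add: push_def)

lemma push_sum: "push h (sum p I) = (\<Sum>i\<in>I. push h (p i))"
  by (simp add: push_def lext_sum)

lemma push_one: "h 0 = 0 \<Longrightarrow> push h 1 = 1"
  by (simp add: push_def lext_one)

lemma push_mult:
  assumes "\<And>a b. a \<in> Poly_Mapping.keys p \<Longrightarrow> b \<in> Poly_Mapping.keys q \<Longrightarrow> h (a + b) = i a + j b"
  shows "push h (p * q) = push i p * push j q"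
  unfolding push_def by (rule lext_mult) (simp add: assms mult_single)

lemma push_id_on:
  assumes "\<And>k. k \<in> Poly_Mapping.keys p \<Longrightarrow> h k = k"
  shows "push h p = p"
proof -
  have "push h p = (\<Sum>k\<in>Poly_Mapping.keys p. Poly_Mapping.single k (Poly_Mapping.lookup p k))"
    by (simp add: push_def lext_def mult_single assms)
  thus ?thesis by (simp add: sum_single_keys)
qed

lemma push_cong:
  assumes "\<And>k. k \<in> Poly_Mapping.keys p \<Longrightarrow> h k = i k"
  shows "push h p = push i p"
  unfolding push_def by (rule lext_cong) (simp add: assms)

lemma push_push: "push h (push i p) = push (\<lambda>k. h (i k)) p"
proof -
  have "push h (push i p) = push h (\<Sum>k\<in>Poly_Mapping.keys p. Poly_Mapping.single (i k) (Poly_Mapping.lookup p k))"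
    by (simp add: push_def[of i] lext_def mult_single)
  also have "\<dots> = push (\<lambda>k. h (i k)) p"
    by (simp add: push_sum push_single push_def[of "\<lambda>k. h (i k)"] lext_def mult_single)
  finally show ?thesis .
qed

section \<open>Support on set compositions\<close>

text \<open>
  None of the conditions on the right depends on the order of the blocks, and all but the last pass
  to sublists; this makes reordering and filtering of set compositions easy.
\<close>

lemma set_comps_iff:
  "P \<in> set_comps A \<longleftrightarrow> {} \<notin> set P \<and> distinct P \<and> pairwise disjnt (set P) \<and> \<Union>(set P) = A"
proof -
  have "(\<forall>i<length P. \<forall>j<length P. i \<noteq> j \<longrightarrow> P ! i \<inter> P ! j = {}) \<longleftrightarrow>
      distinct P \<and> pairwise disjnt (set P)" if ne: "{} \<notin> set P"
  proof (intro iffI conjI)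
    assume *: "\<forall>i<length P. \<forall>j<length P. i \<noteq> j \<longrightarrow> P ! i \<inter> P ! j = {}"
    have "P ! i \<noteq> P ! j" if "i < length P" "j < length P" "i \<noteq> j" for i j
      using * that ne nth_mem[of i P] by (metis inf.idem)
    thus "distinct P" by (simp add: distinct_conv_nth)
    show "pairwise disjnt (set P)"
    proof (rule pairwiseI)
      fix p q assume "p \<in> set P" "q \<in> set P" "p \<noteq> q"
      then obtain i j where "i < length P" "j < length P" "p = P ! i" "q = P ! j" "i \<noteq> j"
        by (metis in_set_conv_nth)
      thus "disjnt p q" using * by (simp add: disjnt_def)
    qed
  next
    assume "distinct P \<and> pairwise disjnt (set P)"
    thus "\<forall>i<length P. \<forall>j<length P. i \<noteq> j \<longrightarrow> P ! i \<inter> P ! j = {}"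
      by (metis disjnt_def nth_eq_iff_index_eq nth_mem pairwiseD)
  qed
  thus ?thesis unfolding set_comps_def mem_Collect_eq by metis
qed

lemma set_comps_Cons_iff:
  "U # P \<in> set_comps B \<longleftrightarrow> U \<noteq> {} \<and> U \<subseteq> B \<and> P \<in> set_comps (B - U)"
  by (auto simp: set_comps_iff pairwise_insert disjnt_def)

lemma set_comps_block_unique:
  "P \<in> set_comps A \<Longrightarrow> p \<in> set P \<Longrightarrow> q \<in> set P \<Longrightarrow> x \<in> p \<Longrightarrow> x \<in> q \<Longrightarrow> p = q"
  by (metis disjnt_iff pairwiseD set_comps_iff)

lemma set_comps_empty: "set_comps {} = {[]}"
proof -
  have "P \<in> set_comps {} \<longleftrightarrow> P = []" for P
    by (cases P) (simp_all add: set_comps_Cons_iff set_comps_iff[of "[]"])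
  thus ?thesis by blast
qed

lemma set_comps_append:
  "P \<in> set_comps A \<Longrightarrow> Q \<in> set_comps B \<Longrightarrow> A \<inter> B = {} \<Longrightarrow> P @ Q \<in> set_comps (A \<union> B)"
proof (induction P arbitrary: A)
  case Nil
  thus ?case by (simp add: set_comps_iff)
next
  case (Cons p P)
  hence "p \<noteq> {}" "p \<subseteq> A" "P @ Q \<in> set_comps ((A - p) \<union> B)"
    by (auto simp: set_comps_Cons_iff)
  moreover have "(A - p) \<union> B = (A \<union> B) - p" using Cons.prems(3) \<open>p \<subseteq> A\<close> by blast
  ultimately show ?case by (auto simp: set_comps_Cons_iff)
qed

definition supp_on :: "nat set \<Rightarrow> 'f::field comp_space \<Rightarrow> bool" where
  "supp_on A f \<longleftrightarrow> Poly_Mapping.keys f \<subseteq> set_comps A"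

lemma supp_on_zero: "supp_on A 0"
  by (simp add: supp_on_def)

lemma supp_on_basis: "P \<in> set_comps A \<Longrightarrow> supp_on A (basis P)"
  by (simp add: supp_on_def basis_def)

lemma supp_on_one: "supp_on {} 1"
  using supp_on_basis[of "[]" "{}"] by (simp add: basis_Nil set_comps_empty)

lemma supp_on_add: "supp_on A f \<Longrightarrow> supp_on A g \<Longrightarrow> supp_on A (f + g)"
  using keys_add[of f g] by (auto simp: supp_on_def)

lemma supp_on_uminus: "supp_on A f \<Longrightarrow> supp_on A (- f)"
  by (auto simp: supp_on_def in_keys_iff)

lemma supp_on_sum: "(\<And>i. i \<in> I \<Longrightarrow> supp_on A (f i)) \<Longrightarrow> supp_on A (sum f I)"
  by (induction I rule: infinite_finite_induct) (simp_all add: supp_on_zero supp_on_add)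

lemma supp_on_sign: "supp_on A f \<Longrightarrow> supp_on A ((-1) ^ n * f)"
  by (induction n) (simp_all add: supp_on_uminus)

lemma supp_on_mult:
  assumes "supp_on A f" "supp_on B g" "A \<inter> B = {}"
  shows "supp_on (A \<union> B) (f * g)"
  using keys_mult[of f g] assms set_comps_append[OF _ _ assms(3)]
  by (fastforce simp: supp_on_def plus_list_def)

text \<open>
  The case of \<open>vee_basis\<close> in which the product is zero never occurs on disjoint ground sets.
\<close>

lemma vee_eq_mult:
  assumes "supp_on A f" "supp_on B g" "A \<inter> B = {}"
  shows "f \<curlyvee> g = f * g"
proof -
  have "f \<curlyvee> g = lext (\<lambda>P. lext (vee_basis P) g) f"
    by (simp add: vee_def bilin_ext_def lin_ext_eq_lext)
  also have "\<dots> = lext (\<lambda>P. basis P * g) f"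
  proof (rule lext_cong)
    fix P assume P: "P \<in> Poly_Mapping.keys f"
    have "lext (vee_basis P) g = lext (\<lambda>Q. basis P * basis Q) g"
    proof (rule lext_cong)
      fix Q assume "Q \<in> Poly_Mapping.keys g"
      hence "P \<in> set_comps A" "Q \<in> set_comps B" using P assms by (auto simp: supp_on_def)
      hence "\<Union>(set P) \<inter> \<Union>(set Q) = {}" using assms(3) by (simp add: set_comps_iff)
      thus "vee_basis P Q = (basis P * basis Q :: 'a comp_space)"
        by (simp add: vee_basis_def basis_mult)
    qed
    also have "\<dots> = lext (\<lambda>Q. basis P * basis Q) (1 * g)"
      by simp
    also have "\<dots> = basis P * lext basis g"
      by (subst lext_mult[where u = "\<lambda>R. basis P" and v = basis])
        (auto simp: lext_one zero_list_def plus_list_def)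
    also have "lext basis g = g"
      using push_id_on[of g "\<lambda>k. k"] by (simp add: push_def basis_def[abs_def])
    finally show "lext (vee_basis P) g = basis P * g" .
  qed
  also have "\<dots> = lext (\<lambda>P. basis P * g) (f * 1)"
    by simp
  also have "\<dots> = lext basis f * g"
    by (subst lext_mult[where u = basis and v = "\<lambda>R. g"])
      (auto simp: lext_one zero_list_def plus_list_def)
  also have "lext basis f = f"
    using push_id_on[of f "\<lambda>k. k"] by (simp add: push_def basis_def[abs_def])
  finally show ?thesis .
qed

lemma vee_list_eq_prod_list:
  assumes "P \<in> set_comps A" "\<And>p. p \<in> set P \<Longrightarrow> supp_on p (F p)"
  shows "vee_list (map F P) = prod_list (map F P) \<and> supp_on A (prod_list (map F P))"
  using assms
proof (induction P arbitrary: A)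
  case Nil
  thus ?case by (simp add: vee_list_def basis_Nil supp_on_one set_comps_iff)
next
  case (Cons p P)
  from Cons.prems(1) have p: "p \<subseteq> A" and P: "P \<in> set_comps (A - p)"
    by (auto simp: set_comps_Cons_iff)
  have F: "supp_on p (F p)" using Cons.prems(2) by simp
  have IH: "vee_list (map F P) = prod_list (map F P)" "supp_on (A - p) (prod_list (map F P))"
    using Cons.IH[OF P] Cons.prems(2) by simp_all
  have "vee_list (map F (p # P)) = F p \<curlyvee> vee_list (map F P)"
    by (simp add: vee_list_def)
  also have "\<dots> = prod_list (map F (p # P))"
    using vee_eq_mult[OF F IH(2)] IH(1) by simp
  finally show ?case
    using supp_on_mult[OF F IH(2)] p by (auto simp: Un_absorb1)
qed

section \<open>Restriction coproduct\<close>

definition restrict_comp :: "nat set list \<Rightarrow> nat set \<Rightarrow> nat set list" where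
  "restrict_comp R X = filter (\<lambda>B. B \<noteq> {}) (map (\<lambda>B. B \<inter> X) R)"

lemma restrict_comp_append: "restrict_comp (R @ S) X = restrict_comp R X @ restrict_comp S X"
  by (simp add: restrict_comp_def)

lemma restrict_comp_id: "R \<in> set_comps B \<Longrightarrow> B \<subseteq> X \<Longrightarrow> restrict_comp R X = R"
proof (induction R arbitrary: B)
  case Nil
  thus ?case by (simp add: restrict_comp_def)
next
  case (Cons U R)
  hence "restrict_comp R X = R" "U \<noteq> {}" "U \<inter> X = U" by (auto simp: set_comps_Cons_iff)
  thus ?case by (simp add: restrict_comp_def)
qed

lemma restrict_comp_disjoint: "R \<in> set_comps B \<Longrightarrow> B \<inter> X = {} \<Longrightarrow> restrict_comp R X = []"
  by (auto simp: restrict_comp_def set_comps_iff filter_empty_conv)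

text \<open>
  The tensor square of the free algebra is the monoid algebra of the product monoid; \<open>inl f\<close> and
  \<open>inr g\<close> below are \<open>f \<otimes> 1\<close> and \<open>1 \<otimes> g\<close>.
\<close>

type_synonym 'f tensor_space = "(nat set list \<times> nat set list) \<Rightarrow>\<^sub>0 'f"

definition coprod :: "nat set \<Rightarrow> nat set \<Rightarrow> 'f::field comp_space \<Rightarrow> 'f tensor_space" where
  "coprod X Y = push (\<lambda>R. (restrict_comp R X, restrict_comp R Y))"

definition inl :: "'f::field comp_space \<Rightarrow> 'f tensor_space" where
  "inl = push (\<lambda>R. (R, []))"

definition inr :: "'f::field comp_space \<Rightarrow> 'f tensor_space" where
  "inr = push (\<lambda>R. ([], R))"

lemma coprod_sum: "coprod X Y (sum f I) = (\<Sum>i\<in>I. coprod X Y (f i))"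
  and inl_sum: "inl (sum f I) = (\<Sum>i\<in>I. inl (f i))"
  and inr_sum: "inr (sum f I) = (\<Sum>i\<in>I. inr (f i))"
  by (simp_all add: coprod_def inl_def inr_def push_sum)

lemma coprod_zero [simp]: "coprod X Y 0 = 0"
  and inl_zero [simp]: "inl 0 = 0"
  and inr_zero [simp]: "inr 0 = 0"
  by (simp_all add: coprod_def inl_def inr_def)

lemma coprod_one [simp]: "coprod X Y 1 = 1"
  and inl_one [simp]: "inl 1 = 1"
  and inr_one [simp]: "inr 1 = 1"
  by (simp_all add: coprod_def inl_def inr_def push_one zero_prod_def zero_list_def restrict_comp_def)

lemma coprod_mult: "coprod X Y (f * g) = coprod X Y f * coprod X Y g"
  unfolding coprod_def by (rule push_mult) (simp add: plus_list_def restrict_comp_append)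

lemma inl_mult: "inl (f * g) = inl f * inl g"
  unfolding inl_def by (rule push_mult) (simp add: plus_list_def)

lemma inr_mult: "inr (f * g) = inr f * inr g"
  unfolding inr_def by (rule push_mult) (simp add: plus_list_def)

lemma inl_inr_commute: "inr g * inl f = inl f * inr g"
  unfolding inl_def inr_def push_def lext_def
  by (subst (1 2) sum_product, subst sum.swap) (simp add: mult_single plus_list_def mult.commute)

lemma tensor_mult: "(inl f * inr g) * (inl f' * inr g') = inl (f * f') * inr (g * g')"
  by (metis (no_types, lifting) inl_inr_commute inl_mult inr_mult mult.assoc)

section \<open>Blocks, their inverses and primitivity\<close>

lemma sum_Pow_split:
  assumes "B \<subseteq> X \<union> Y" "X \<inter> Y = {}"
  shows "(\<Sum>U\<in>Pow B. h (U \<inter> X) (U \<inter> Y)) = (\<Sum>V\<in>Pow (B \<inter> X). \<Sum>W\<in>Pow (B \<inter> Y). h V W)"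
  unfolding sum.cartesian_product
  by (rule sum.reindex_bij_witness[where i = "\<lambda>(V, W). V \<union> W" and j = "\<lambda>U. (U \<inter> X, U \<inter> Y)"])
    (use assms in \<open>auto 0 3\<close>)

text \<open>
  A set composition of a non-empty set is a first block followed by a set composition of the rest.
\<close>

lemma sum_set_comps:
  assumes "finite B" "B \<noteq> {}"
  shows "(\<Sum>P\<in>set_comps B. h P) = (\<Sum>U\<in>Pow B - {{}}. \<Sum>P\<in>set_comps (B - U). h (U # P))"
proof -
  have "(\<Sum>U\<in>Pow B - {{}}. \<Sum>P\<in>set_comps (B - U). h (U # P)) =
      (\<Sum>(U, P)\<in>Sigma (Pow B - {{}}) (\<lambda>U. set_comps (B - U)). h (U # P))"
    using assms(1) by (intro sum.Sigma) (auto intro: finite_set_comps)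
  also have "\<dots> = (\<Sum>P\<in>set_comps B. h P)"
  proof (rule sum.reindex_bij_witness[where i = "\<lambda>P. (hd P, tl P)" and j = "\<lambda>(U, P). U # P"])
    fix P assume P: "P \<in> set_comps B"
    then obtain U P' where [simp]: "P = U # P'" using assms(2) by (cases P) (auto simp: set_comps_iff)
    show "(case (hd P, tl P) of (U, P) \<Rightarrow> U # P) = P"
      and "(hd P, tl P) \<in> Sigma (Pow B - {{}}) (\<lambda>U. set_comps (B - U))"
      using P by (auto simp: set_comps_Cons_iff)
  qed (auto simp: set_comps_Cons_iff)
  finally show ?thesis by simp
qed

definition block :: "nat set \<Rightarrow> 'f::field comp_space" where
  "block U = (if U = {} then 1 else basis [U])"

text \<open>
  The value at \<open>B\<close> of the convolution inverse of the family of one-block compositions; in the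
  language of Hopf algebras, the antipode of \<open>(B)\<close>.
\<close>

definition inv_block :: "nat set \<Rightarrow> 'f::field comp_space" where
  "inv_block B = (\<Sum>P\<in>set_comps B. (-1) ^ length P * basis P)"

lemma inv_block_empty [simp]: "inv_block {} = 1"
  by (simp add: inv_block_def set_comps_empty basis_Nil)

lemma supp_on_block: "supp_on U (block U)"
  by (auto simp: block_def supp_on_one set_comps_Cons_iff set_comps_empty intro: supp_on_basis)

lemma supp_on_inv_block: "supp_on B (inv_block B)"
  unfolding inv_block_def by (intro supp_on_sum supp_on_sign supp_on_basis)

lemma sign_basis_Cons:
  "(-1) ^ n * basis (U # P) = (basis [U] * ((-1) ^ n * basis P) :: 'f::field comp_space)"
  by (induction n) (simp_all add: basis_mult)

text \<open>
  Peeling the first block off each term of \<open>inv_block B\<close> turns it into minus the sum over the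
  non-empty \<open>U\<close>, which cancels the term for \<open>U = {}\<close>.
\<close>

lemma block_inverse:
  assumes "finite B"
  shows "(\<Sum>U\<in>Pow B. block U * inv_block (B - U)) = (if B = {} then 1 else 0 :: 'f::field comp_space)"
proof (cases "B = {}")
  case False
  have "inv_block B = (\<Sum>U\<in>Pow B - {{}}. \<Sum>P\<in>set_comps (B - U). (-1) ^ Suc (length P) * basis (U # P) :: 'f comp_space)"
    unfolding inv_block_def by (subst sum_set_comps[OF assms False]) simp
  also have "\<dots> = (\<Sum>U\<in>Pow B - {{}}. - (block U * inv_block (B - U)))"
    by (intro sum.cong refl)
      (simp only: sign_basis_Cons, auto simp: block_def inv_block_def sum_distrib_left sum_negf)
  finally show ?thesis using False assms
    by (simp add: sum.remove[of "Pow B" "{}"] block_def[of "{}"] sum_negf)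
qed (simp add: block_def)

lemma e_block_eq:
  assumes "finite B" "B \<noteq> {}"
  shows "e_block B =
    (\<Sum>U\<in>Pow B. if Min B \<in> U then block U * inv_block (B - U) else 0 :: 'f::field comp_space)"
proof -
  have sc: "scale ((-1) ^ n) f = (-1) ^ n * f" for n and f :: "'f comp_space"
    by (rule poly_mapping_eqI, induction n) auto
  have "e_block B = (\<Sum>P\<in>set_comps B. if Min B \<in> hd P then (-1) ^ (length P - 1) * basis P else 0 :: 'f comp_space)"
    unfolding e_block_def sc by (rule sum.inter_filter) (simp add: finite_set_comps assms)
  also have "\<dots> = (\<Sum>U\<in>Pow B - {{}}. \<Sum>P\<in>set_comps (B - U).
      if Min B \<in> U then (-1) ^ length P * basis (U # P) else 0)"
    by (subst sum_set_comps[OF assms]) (simp only: list.sel length_Cons diff_Suc_1)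
  also have "\<dots> = (\<Sum>U\<in>Pow B - {{}}. if Min B \<in> U then block U * inv_block (B - U) else 0)"
    by (intro sum.cong refl)
      (auto simp: block_def inv_block_def sum_distrib_left sign_basis_Cons)
  also have "\<dots> = (\<Sum>U\<in>Pow B. if Min B \<in> U then block U * inv_block (B - U) else 0)"
    by (rule sum.mono_neutral_left) (use assms in auto)
  finally show ?thesis .
qed

lemma supp_on_e_block:
  assumes "finite B" "B \<noteq> {}"
  shows "supp_on B (e_block B)"
proof -
  have "supp_on B (block U * inv_block (B - U))" if "U \<subseteq> B" for U
    using supp_on_mult[OF supp_on_block[of U] supp_on_inv_block[of "B - U"]] that
    by (simp add: Un_absorb1)
  thus ?thesis unfolding e_block_eq[OF assms]
    by (intro supp_on_sum) (auto simp: supp_on_zero)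
qed

lemma coprod_block:
  assumes "U \<subseteq> X \<union> Y"
  shows "coprod X Y (block U) = inl (block (U \<inter> X)) * inr (block (U \<inter> Y) :: 'f::field comp_space)"
proof -
  have block: "block V = (basis (if V = {} then [] else [V]) :: 'f comp_space)" for V
    by (simp add: block_def basis_Nil)
  show ?thesis using assms
    by (auto simp: block coprod_def inl_def inr_def push_basis mult_single plus_list_def
        restrict_comp_def)
qed

text \<open>
  The inverse of a grouplike family is grouplike.  Both \<open>coprod X Y (inv_block B)\<close> and the product
  on the right solve the same recursion: each becomes zero when the terms for non-empty \<open>U\<close> of the
  convolution sum for \<open>B\<close> are added, since the sums over \<open>U \<inter> X\<close> and \<open>U \<inter> Y\<close> separate and one of
  \<open>B \<inter> X\<close> and \<open>B \<inter> Y\<close> is non-empty.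
\<close>

lemma coprod_inv_block:
  assumes "finite B" "B \<subseteq> X \<union> Y" "X \<inter> Y = {}"
  shows "coprod X Y (inv_block B) = inl (inv_block (B \<inter> X)) * inr (inv_block (B \<inter> Y) :: 'f::field comp_space)"
  using assms(1,2)
proof (induction B rule: finite_psubset_induct)
  case (psubset B)
  show ?case
  proof (cases "B = {}")
    case False
    let ?h = "\<lambda>V W. inl (block V * inv_block (B \<inter> X - V)) * inr (block W * inv_block (B \<inter> Y - W) :: 'f comp_space)"
    have h: "coprod X Y (block U) * (inl (inv_block ((B - U) \<inter> X)) * inr (inv_block ((B - U) \<inter> Y))) = ?h (U \<inter> X) (U \<inter> Y)"
      if "U \<subseteq> B" for U
    proof -
      have "(B - U) \<inter> X = B \<inter> X - U \<inter> X" "(B - U) \<inter> Y = B \<inter> Y - U \<inter> Y" by auto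
      thus ?thesis using that psubset.prems by (simp add: coprod_block tensor_mult)
    qed
    \<comment> \<open>The two convolution sums separate; one of them runs over a non-empty set and vanishes.\<close>
    have "(\<Sum>U\<in>Pow B. ?h (U \<inter> X) (U \<inter> Y)) =
        inl (\<Sum>V\<in>Pow (B \<inter> X). block V * inv_block (B \<inter> X - V)) *
        inr (\<Sum>W\<in>Pow (B \<inter> Y). block W * inv_block (B \<inter> Y - W))"
      by (subst sum_Pow_split[where h = ?h, OF psubset.prems assms(3)])
        (simp add: inl_sum inr_sum sum_product)
    also have "\<dots> = 0"
      using False psubset.prems psubset.hyps by (auto simp: block_inverse simp del: Pow_Int_eq)
    finally have "?h {} {} + (\<Sum>U\<in>Pow B - {{}}. ?h (U \<inter> X) (U \<inter> Y)) = 0"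
      using psubset.hyps by (simp add: sum.remove[of "Pow B" "{}"])
    moreover have "(\<Sum>U\<in>Pow B - {{}}. ?h (U \<inter> X) (U \<inter> Y)) =
        (\<Sum>U\<in>Pow B - {{}}. coprod X Y (block U * inv_block (B - U)))"
    proof (intro sum.cong refl)
      fix U assume U: "U \<in> Pow B - {{}}"
      have "B - U \<subset> B" "B - U \<subseteq> X \<union> Y" using U psubset.prems by auto
      thus "?h (U \<inter> X) (U \<inter> Y) = coprod X Y (block U * inv_block (B - U))"
        using psubset.IH h U by (simp add: coprod_mult)
    qed
    moreover have "coprod X Y (inv_block B) + (\<Sum>U\<in>Pow B - {{}}. coprod X Y (block U * inv_block (B - U))) =
        coprod X Y (\<Sum>U\<in>Pow B. block U * inv_block (B - U) :: 'f comp_space)"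
      unfolding coprod_sum
      using psubset.hyps by (simp add: sum.remove[of "Pow B" "{}"] block_def[of "{}"])
    ultimately have 1: "inl (inv_block (B \<inter> X)) * inr (inv_block (B \<inter> Y) :: 'f comp_space) +
        (\<Sum>U\<in>Pow B - {{}}. coprod X Y (block U * inv_block (B - U))) = 0"
      and 2: "coprod X Y (inv_block B :: 'f comp_space) +
        (\<Sum>U\<in>Pow B - {{}}. coprod X Y (block U * inv_block (B - U))) = 0"
      using False psubset.hyps by (simp_all add: block_inverse block_def[of "{}"])
    show ?thesis by (rule add_right_imp_eq[OF trans[OF 2 1[symmetric]]])
  qed simp
qed

text \<open>
  Primitivity.  When \<open>B\<close> meets both sets, the condition \<open>Min B \<in> U\<close> constrains only one of the two
  independent sums over \<open>U \<inter> X\<close> and \<open>U \<inter> Y\<close>; the other one is a full convolution sum over a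
  non-empty set, which is zero by \<open>block_inverse\<close>.
\<close>

lemma coprod_e_block:
  assumes "finite B" "B \<noteq> {}" "B \<subseteq> X \<union> Y" "X \<inter> Y = {}"
  shows "coprod X Y (e_block B) =
    (if B \<subseteq> X then inl (e_block B) else if B \<subseteq> Y then inr (e_block B) else 0 :: 'f::field tensor_space)"
proof -
  have keys: "R \<in> set_comps B" if "R \<in> Poly_Mapping.keys (e_block B :: 'f comp_space)" for R
    using supp_on_e_block[OF assms(1,2)] that by (auto simp: supp_on_def)
  consider "B \<subseteq> X" | "B \<subseteq> Y" "\<not> B \<subseteq> X" | "\<not> B \<subseteq> X" "\<not> B \<subseteq> Y" by blast
  thus ?thesis
  proof cases
    case 1
    moreover have "B \<inter> Y = {}" using 1 assms(4) by blast
    ultimately show ?thesis unfolding coprod_def inl_def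
      by (auto intro!: push_cong simp: keys restrict_comp_id[OF keys] restrict_comp_disjoint[OF keys])
  next
    case 2
    moreover have "B \<inter> X = {}" using 2 assms(4) by blast
    ultimately show ?thesis unfolding coprod_def inr_def
      by (auto intro!: push_cong simp: keys restrict_comp_id[OF keys] restrict_comp_disjoint[OF keys])
  next
    case 3
    let ?f = "\<lambda>V. block V * inv_block (B \<inter> X - V) :: 'f comp_space"
    let ?g = "\<lambda>W. block W * inv_block (B \<inter> Y - W) :: 'f comp_space"
    let ?h = "\<lambda>V W. if Min B \<in> V \<union> W then inl (?f V) * inr (?g W) else 0"
    have "coprod X Y (e_block B) = (\<Sum>U\<in>Pow B. ?h (U \<inter> X) (U \<inter> Y))"
      unfolding e_block_eq[OF assms(1,2)] coprod_sum
    proof (intro sum.cong refl)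
      fix U assume U: "U \<in> Pow B"
      have "(B - U) \<inter> X = B \<inter> X - U \<inter> X" "(B - U) \<inter> Y = B \<inter> Y - U \<inter> Y" by auto
      moreover have "U \<subseteq> X \<union> Y" "B - U \<subseteq> X \<union> Y" "U \<inter> X \<union> U \<inter> Y = U" using U assms(3) by auto
      ultimately show "coprod X Y (if Min B \<in> U then block U * inv_block (B - U) else 0) = ?h (U \<inter> X) (U \<inter> Y)"
        using assms(1,4) by (simp add: coprod_mult coprod_block coprod_inv_block tensor_mult)
    qed
    also have "\<dots> = (\<Sum>V\<in>Pow (B \<inter> X). \<Sum>W\<in>Pow (B \<inter> Y). ?h V W)"
      by (rule sum_Pow_split[where h = ?h, OF assms(3,4)])
    also have "\<dots> = 0"
    proof -
      have X0: "(\<Sum>V\<in>Pow (B \<inter> X). ?f V) = 0" and Y0: "(\<Sum>W\<in>Pow (B \<inter> Y). ?g W) = 0"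
        using 3 assms by (auto simp: block_inverse simp del: Pow_Int_eq)
      have "Min B \<in> X \<or> Min B \<in> Y" using Min_in[OF assms(1,2)] assms(3) by blast
      thus ?thesis
      proof
        assume m: "Min B \<in> X"
        have "(\<Sum>W\<in>Pow (B \<inter> Y). ?h V W) = (if Min B \<in> V then inl (?f V) * inr (\<Sum>W\<in>Pow (B \<inter> Y). ?g W) else 0)" for V
          unfolding inr_sum sum_distrib_left
          by (cases "Min B \<in> V") (use m assms(4) in \<open>auto intro!: sum.neutral sum.cong\<close>)
        thus ?thesis by (simp add: Y0 del: Pow_Int_eq cong: if_cong)
      next
        assume m: "Min B \<in> Y"
        have "(\<Sum>V\<in>Pow (B \<inter> X). ?h V W) = (if Min B \<in> W then inl (\<Sum>V\<in>Pow (B \<inter> X). ?f V) * inr (?g W) else 0)" for W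
          unfolding inl_sum sum_distrib_right
          by (cases "Min B \<in> W") (use m assms(4) in \<open>auto intro!: sum.neutral sum.cong\<close>)
        thus ?thesis by (subst sum.swap) (simp add: X0 del: Pow_Int_eq cong: if_cong)
      qed
    qed
    finally show ?thesis using 3 by simp
  qed
qed

section \<open>Products of primitive elements\<close>

abbreviation blocks_in :: "nat set list \<Rightarrow> nat set \<Rightarrow> nat set list" where
  "blocks_in Q X \<equiv> filter (\<lambda>q. q \<subseteq> X) Q"

lemma set_comps_blocks_in:
  assumes "Q \<in> set_comps (X \<union> Y)" "X \<inter> Y = {}" "\<forall>q\<in>set Q. q \<subseteq> X \<or> q \<subseteq> Y"
  shows "blocks_in Q X \<in> set_comps X"
proof -
  have "\<Union>(set (blocks_in Q X)) = X"
  proof (intro equalityI subsetI)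
    fix x assume x: "x \<in> X"
    have "\<Union>(set Q) = X \<union> Y" using assms(1) by (simp add: set_comps_iff)
    then obtain q where "q \<in> set Q" "x \<in> q" using x by blast
    thus "x \<in> \<Union>(set (blocks_in Q X))" using x assms(2,3) by auto
  qed auto
  moreover have "pairwise disjnt (set (blocks_in Q X))"
    using assms(1) by (auto simp: set_comps_iff intro: pairwise_mono)
  ultimately show ?thesis using assms(1) by (simp add: set_comps_iff)
qed

lemma set_comps_reorder:
  "R \<in> set_comps A \<Longrightarrow> distinct R' \<Longrightarrow> set R' = set R \<Longrightarrow> R' \<in> set_comps A"
  by (simp add: set_comps_iff)

lemma e_comp_eq_prod_list:
  assumes "finite A" "Q \<in> set_comps A"
  shows "e_comp Q = (prod_list (map e_block Q) :: 'f::field comp_space)"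
    and "supp_on A (e_comp Q :: 'f comp_space)"
proof -
  have "finite q" "q \<noteq> {}" if "q \<in> set Q" for q
    using that assms by (auto simp: set_comps_iff intro: finite_subset)
  hence "vee_list (map e_block Q) = (prod_list (map e_block Q) :: 'f comp_space) \<and>
      supp_on A (prod_list (map e_block Q) :: 'f comp_space)"
    by (intro vee_list_eq_prod_list[OF assms(2)] supp_on_e_block)
  thus "e_comp Q = (prod_list (map e_block Q) :: 'f comp_space)" "supp_on A (e_comp Q :: 'f comp_space)"
    by (simp_all add: e_comp_def)
qed

lemma e_comp_Nil [simp]: "e_comp [] = 1"
  by (simp add: e_comp_def vee_list_def basis_Nil)

lemma e_comp_append:
  assumes "finite A" "Q @ R \<in> set_comps A"
  shows "e_comp (Q @ R) = e_comp Q * e_comp R"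
proof -
  have "Q \<in> set_comps (\<Union>(set Q))" "R \<in> set_comps (\<Union>(set R))"
    using assms(2) by (auto simp: set_comps_iff intro: pairwise_mono)
  moreover have "finite (\<Union>(set Q))" "finite (\<Union>(set R))"
    using assms by (auto simp: set_comps_iff)
  ultimately show ?thesis
    using assms by (simp add: e_comp_eq_prod_list(1)[of A] e_comp_eq_prod_list(1)[of "\<Union>(set Q)" Q]
        e_comp_eq_prod_list(1)[of "\<Union>(set R)" R])
qed

text \<open>
  Since \<open>coprod X Y\<close> is multiplicative, primitivity of the factors leaves a single term: the factors
  inside \<open>X\<close> go to the left leg and those inside \<open>Y\<close> to the right leg.
\<close>

lemma coprod_e_comp:
  assumes "finite X" "finite Y" "X \<inter> Y = {}" "Q \<in> set_comps (X \<union> Y)"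
  shows "coprod X Y (e_comp Q) =
    (if \<forall>q\<in>set Q. q \<subseteq> X \<or> q \<subseteq> Y
     then inl (e_comp (blocks_in Q X)) * inr (e_comp (blocks_in Q Y)) else 0 :: 'f::field tensor_space)"
proof -
  have "coprod X Y (prod_list (map e_block R)) =
      (if \<forall>q\<in>set R. q \<subseteq> X \<or> q \<subseteq> Y
       then inl (prod_list (map e_block (blocks_in R X))) * inr (prod_list (map e_block (blocks_in R Y)))
       else 0 :: 'f tensor_space)"
    if "{} \<notin> set R" "\<Union>(set R) \<subseteq> X \<union> Y" for R
    using that
  proof (induction R)
    case (Cons q R)
    have q: "finite q" "q \<noteq> {}" "q \<subseteq> X \<union> Y"
      using Cons.prems assms(1,2) by (auto intro: finite_subset[of q "X \<union> Y"])
    hence *: "\<not> (q \<subseteq> X \<and> q \<subseteq> Y)" using assms(3) by blast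
    have IH: "coprod X Y (prod_list (map e_block R)) =
      (if \<forall>q\<in>set R. q \<subseteq> X \<or> q \<subseteq> Y
       then inl (prod_list (map e_block (blocks_in R X))) * inr (prod_list (map e_block (blocks_in R Y)))
       else 0 :: 'f tensor_space)"
      using Cons by simp
    have comm: "inr b * (inl a * inr c) = inl a * inr (b * c)" for a b c :: "'f comp_space"
      by (simp only: mult.assoc[symmetric] inl_inr_commute inr_mult)
    have e: "coprod X Y (prod_list (map e_block (q # R))) =
        coprod X Y (e_block q) * coprod X Y (prod_list (map e_block R) :: 'f comp_space)"
      by (simp add: coprod_mult)
    consider "q \<subseteq> X" "\<not> q \<subseteq> Y" | "q \<subseteq> Y" "\<not> q \<subseteq> X" | "\<not> q \<subseteq> X" "\<not> q \<subseteq> Y"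
      using * by blast
    thus ?case
      unfolding e IH coprod_e_block[OF q assms(3)]
      by cases (auto simp: comm inl_mult mult.assoc)
  qed simp
  from this[of Q] have *: "coprod X Y (prod_list (map e_block Q)) =
      (if \<forall>q\<in>set Q. q \<subseteq> X \<or> q \<subseteq> Y
       then inl (prod_list (map e_block (blocks_in Q X))) * inr (prod_list (map e_block (blocks_in Q Y)))
       else 0 :: 'f tensor_space)"
    using assms(4) by (simp add: set_comps_iff)
  have Q: "finite (X \<union> Y)" using assms by simp
  show ?thesis
  proof (cases "\<forall>q\<in>set Q. q \<subseteq> X \<or> q \<subseteq> Y")
    case True
    have "blocks_in Q X \<in> set_comps X" "blocks_in Q Y \<in> set_comps Y"
      using True assms set_comps_blocks_in[of Q X Y] set_comps_blocks_in[of Q Y X]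
      by (auto simp: Un_commute Int_commute)
    thus ?thesis using * True assms(1,2)
      by (simp add: e_comp_eq_prod_list(1)[OF Q assms(4)] e_comp_eq_prod_list(1)[of X]
          e_comp_eq_prod_list(1)[of Y])
  next
    case False
    show ?thesis
      unfolding e_comp_eq_prod_list(1)[OF Q assms(4)] * by (simp only: False if_False)
  qed
qed

section \<open>The product \<open>\<curlywedge>\<close> as an action\<close>

definition meet :: "nat set list \<Rightarrow> nat set list \<Rightarrow> nat set list" where
  "meet P Q = filter (\<lambda>B. B \<noteq> {}) (concat (map (\<lambda>p. map (\<lambda>q. p \<inter> q) Q) P))"

lemma meet_Nil [simp]: "meet [] Q = []"
  by (simp add: meet_def)

lemma meet_Cons: "meet (p # P) Q = restrict_comp Q p @ meet P Q"
proof -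
  have "(\<lambda>q. p \<inter> q) = (\<lambda>q. q \<inter> p)" by (intro ext) (rule Int_commute)
  thus ?thesis by (simp add: meet_def restrict_comp_def)
qed

lemma meet_append: "meet (P @ P') Q = meet P Q @ meet P' Q"
  by (simp add: meet_def)

lemma restrict_comp_restrict_comp:
  "p \<subseteq> X \<Longrightarrow> restrict_comp (restrict_comp Q X) p = restrict_comp Q p"
  by (induction Q) (auto simp: restrict_comp_def Int_assoc Int_absorb1 Int_absorb2)

lemma meet_restrict_comp: "\<Union>(set P) \<subseteq> X \<Longrightarrow> meet P (restrict_comp Q X) = meet P Q"
  by (induction P) (simp_all add: meet_Cons restrict_comp_restrict_comp)

text \<open>
  This is \<open>f \<curlywedge> g\<close> without the comparison of ground sets, so that it is induced by a plain map of words;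
  the two agree when all terms of \<open>f\<close> and \<open>g\<close> have the same ground set.
\<close>

definition act :: "'f::field comp_space \<Rightarrow> 'f comp_space \<Rightarrow> 'f comp_space" where
  "act f g = lext (\<lambda>P. push (meet P) g) f"

lemma wedge_eq_act:
  assumes "supp_on A f" "supp_on A g"
  shows "f \<curlywedge> g = act f g"
proof -
  have "f \<curlywedge> g = lext (\<lambda>P. lext (wedge_basis P) g) f"
    by (simp add: wedge_def bilin_ext_def lin_ext_eq_lext)
  also have "\<dots> = act f g"
    unfolding act_def
  proof (rule lext_cong)
    fix P assume P: "P \<in> Poly_Mapping.keys f"
    show "lext (wedge_basis P) g = push (meet P) g"
      unfolding push_def
    proof (rule lext_cong)
      fix Q assume "Q \<in> Poly_Mapping.keys g"
      hence "P \<in> set_comps A" "Q \<in> set_comps A" using P assms by (auto simp: supp_on_def)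
      thus "wedge_basis P Q = Poly_Mapping.single (meet P Q) 1"
        by (simp add: wedge_basis_def set_comps_iff meet_def basis_def)
    qed
  qed
  finally show ?thesis .
qed

lemma act_sum: "act (sum f I) g = (\<Sum>i\<in>I. act (f i) g)"
  by (simp add: act_def lext_sum)

lemma act_zero [simp]: "act 0 g = 0"
  by (simp add: act_def)

lemma keys_push: "Poly_Mapping.keys (push h f) \<subseteq> h ` Poly_Mapping.keys f"
  unfolding push_def lext_def
  by (rule order.trans[OF keys_sum]) (auto simp: mult_single split: if_splits)

lemma push_tensor:
  "push (\<lambda>(T, T'). u T @ v T') (inl f * inr g) = push u f * (push v g :: 'f::field comp_space)"
  if "u [] = []" "v [] = []"
proof -
  have "push (\<lambda>(T, T'). u T @ v T') (inl f * inr g) = push (\<lambda>x. u (fst x)) (inl f) * push (\<lambda>x. v (snd x)) (inr g)"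
  proof (rule push_mult)
    fix a b assume "a \<in> Poly_Mapping.keys (inl f)" "b \<in> Poly_Mapping.keys (inr g)"
    hence "snd a = []" "fst b = []" using keys_push unfolding inl_def inr_def by fastforce+
    thus "(case a + b of (T, T') \<Rightarrow> u T @ v T') = u (fst a) + v (snd b)"
      by (cases a; cases b) (simp add: plus_list_def)
  qed
  thus ?thesis by (simp add: inl_def inr_def push_push)
qed

text \<open>
  The blocks of \<open>meet (R @ S) T\<close> coming from \<open>R\<close> see only the restriction of \<open>T\<close> to \<open>X\<close>, those from \<open>S\<close>
  only the restriction to \<open>Y\<close>.  So \<open>f * h\<close> acts through the coproduct, and the coproduct of
  \<open>e_comp Q\<close> is a pure tensor or zero.
\<close>

lemma act_mult:
  assumes "finite X" "finite Y" "X \<inter> Y = {}" "Q \<in> set_comps (X \<union> Y)"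
    and f: "supp_on X f" and h: "supp_on Y h"
  shows "act (f * h) (e_comp Q) =
    (if \<forall>q\<in>set Q. q \<subseteq> X \<or> q \<subseteq> Y
     then act f (e_comp (blocks_in Q X)) * act h (e_comp (blocks_in Q Y)) else 0 :: 'f::field comp_space)"
proof -
  have *: "push (meet (R @ S)) (e_comp Q) = push (\<lambda>(T, T'). meet R T @ meet S T') (coprod X Y (e_comp Q) :: 'f tensor_space)"
    if "R \<in> Poly_Mapping.keys f" "S \<in> Poly_Mapping.keys h" for R S
  proof -
    have "R \<in> set_comps X" "S \<in> set_comps Y" using that f h by (auto simp: supp_on_def)
    hence "meet R (restrict_comp T X) = meet R T" "meet S (restrict_comp T Y) = meet S T" for T
      by (simp_all add: meet_restrict_comp set_comps_iff)
    moreover have "meet (R @ S) = (\<lambda>T. meet R T @ meet S T)"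
      by (intro ext) (rule meet_append)
    ultimately show ?thesis by (simp add: coprod_def push_push)
  qed
  show ?thesis
  proof (cases "\<forall>q\<in>set Q. q \<subseteq> X \<or> q \<subseteq> Y")
    case True
    have "push (meet (R @ S)) (e_comp Q) =
        push (meet R) (e_comp (blocks_in Q X)) * push (meet S) (e_comp (blocks_in Q Y) :: 'f comp_space)"
      if "R \<in> Poly_Mapping.keys f" "S \<in> Poly_Mapping.keys h" for R S
    proof -
      have "meet R [] = []" for R by (induction R) (simp_all add: meet_Cons restrict_comp_def)
      thus ?thesis
        using True by (simp add: *[OF that] coprod_e_comp[OF assms(1-4)] push_tensor)
    qed
    hence "lext (\<lambda>P. push (meet P) (e_comp Q)) (f * h) =
        act f (e_comp (blocks_in Q X)) * act h (e_comp (blocks_in Q Y))"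
      unfolding act_def by (intro lext_mult) (simp add: plus_list_def)
    thus ?thesis using True by (simp add: act_def)
  next
    case False
    have "lext (\<lambda>P. push (meet P) (e_comp Q)) (f * h) = lext (\<lambda>_. 0) f * lext (\<lambda>_. 0) h"
      using False by (intro lext_mult) (auto simp: plus_list_def * coprod_e_comp[OF assms(1-4)])
    thus ?thesis using False by (auto simp: act_def lext_def)
  qed
qed

lemma act_one: "act 1 1 = 1"
  by (simp add: act_def lext_one zero_list_def push_one)

lemma act_block:
  assumes "finite U" "Q \<in> set_comps U"
  shows "act (block U) (e_comp Q) = (e_comp Q :: 'f::field comp_space)"
proof (cases "U = {}")
  case True
  thus ?thesis using assms by (simp add: block_def set_comps_empty act_one)
next
  case False
  have "push (meet [U]) (e_comp Q) = (e_comp Q :: 'f comp_space)"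
  proof (rule push_id_on)
    fix R assume "R \<in> Poly_Mapping.keys (e_comp Q :: 'f comp_space)"
    hence "R \<in> set_comps U" using e_comp_eq_prod_list(2)[OF assms, where 'f = 'f] by (auto simp: supp_on_def)
    thus "meet [U] R = R" by (simp add: meet_Cons restrict_comp_id)
  qed
  thus ?thesis using False by (simp add: block_def act_def lext_basis)
qed

lemma act_block_mult:
  assumes "finite A" "U \<subseteq> A" "Q \<in> set_comps A" "supp_on (A - U) h"
  shows "act (block U * h) (e_comp Q) =
    (if \<forall>q\<in>set Q. q \<subseteq> U \<or> q \<subseteq> A - U
     then e_comp (blocks_in Q U) * act h (e_comp (blocks_in Q (A - U))) else 0 :: 'f::field comp_space)"
proof -
  have U: "finite U" "finite (A - U)" "U \<inter> (A - U) = {}" "Q \<in> set_comps (U \<union> (A - U))"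
    using assms by (auto simp: Un_absorb1 intro: finite_subset)
  show ?thesis
    using set_comps_blocks_in[OF U(4,3)]
    by (auto simp: act_mult[OF U supp_on_block assms(4)] act_block[OF U(1)])
qed

section \<open>The Dynkin operator as an alternating sum over subsets\<close>

lemma sum_Pow_insert:
  assumes "finite A" "z \<notin> A"
  shows "(\<Sum>S\<in>Pow (insert z A). h S) = (\<Sum>S\<in>Pow A. h S + h (insert z S))"
proof -
  have "(\<Sum>S\<in>Pow (insert z A). h S) = (\<Sum>S\<in>Pow A. h S) + (\<Sum>S\<in>insert z ` Pow A. h S)"
    unfolding Pow_insert by (rule sum.union_disjoint) (use assms in auto)
  also have "(\<Sum>S\<in>insert z ` Pow A. h S) = (\<Sum>S\<in>Pow A. h (insert z S))"
    by (subst sum.reindex) (use assms(2) in \<open>auto intro!: inj_onI simp: insert_ident\<close>)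
  finally show ?thesis by (simp add: sum.distrib)
qed

text \<open>
  When \<open>S\<close> contains the last entry of \<open>Q\<close>, this is the term indexed by \<open>S\<close> in the expansion of the
  right-normed bracket of the entries of \<open>Q\<close>: each bracket puts its left operand either in front of
  the word or, with a sign, at its end.
\<close>

definition split_word :: "nat set set \<Rightarrow> nat set list \<Rightarrow> 'f::field comp_space" where
  "split_word S Q = (-1) ^ length (filter (\<lambda>q. q \<notin> S) Q) *
     basis (filter (\<lambda>q. q \<in> S) Q @ rev (filter (\<lambda>q. q \<notin> S) Q))"

lemma set_comps_split_word:
  "Q \<in> set_comps A \<Longrightarrow> filter (\<lambda>q. q \<in> S) Q @ rev (filter (\<lambda>q. q \<notin> S) Q) \<in> set_comps A"
  by (rule set_comps_reorder) (auto simp: set_comps_iff)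

lemma supp_on_split_word: "Q \<in> set_comps A \<Longrightarrow> supp_on A (split_word S Q)"
  unfolding split_word_def by (intro supp_on_sign supp_on_basis set_comps_split_word)

lemma filter_insert_notin:
  assumes "z \<notin> set Q"
  shows "filter (\<lambda>q. q \<in> insert z S) Q = filter (\<lambda>q. q \<in> S) Q"
    and "filter (\<lambda>q. q \<notin> insert z S) Q = filter (\<lambda>q. q \<notin> S) Q"
  using assms by (auto intro!: filter_cong)

lemma split_word_insert_last:
  assumes "z \<notin> set Q" "z \<notin> S"
  shows "split_word (insert z S) (Q @ [z]) = - split_word S (Q @ [z])"
  using assms(2) by (simp add: split_word_def filter_insert_notin[OF assms(1)] del: insert_iff)
    (simp add: insert_iff)

text \<open>
  The last entry \<open>z\<close> sits at the junction of the two parts of the word, either as the end of the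
  ordered part or as the start of the reversed part.  So \<open>S\<close> and \<open>insert z S\<close> give the same word
  with opposite signs.
\<close>

lemma sum_split_word_cancel:
  assumes "distinct (Q @ [z])" "\<And>S. S \<subseteq> set Q \<Longrightarrow> C (insert z S) \<longleftrightarrow> C S"
  shows "(\<Sum>S\<in>Pow (set (Q @ [z])). if C S then split_word S (Q @ [z]) else 0) = 0"
proof -
  have "(\<Sum>S\<in>Pow (set (Q @ [z])). if C S then split_word S (Q @ [z]) else 0) =
      (\<Sum>S\<in>Pow (insert z (set Q)). if C S then split_word S (Q @ [z]) else 0)"
    by simp
  also have "\<dots> = 0"
  proof (subst sum_Pow_insert)
    show "finite (set Q)" "z \<notin> set Q" using assms(1) by auto
    show "(\<Sum>S\<in>Pow (set Q). (if C S then split_word S (Q @ [z]) else 0) +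
        (if C (insert z S) then split_word (insert z S) (Q @ [z]) else 0)) = 0"
    proof (intro sum.neutral ballI)
      fix S assume "S \<in> Pow (set Q)"
      hence "z \<notin> set Q" "z \<notin> S" "C (insert z S) \<longleftrightarrow> C S" using assms by auto
      thus "(if C S then split_word S (Q @ [z]) else 0) +
          (if C (insert z S) then split_word (insert z S) (Q @ [z]) else 0) = 0"
        by (simp add: split_word_insert_last)
    qed
  qed
  finally show ?thesis .
qed

lemma split_word_Cons:
  assumes "q \<notin> set Q"
  shows "split_word (insert q S) (q # Q) = basis [q] * (split_word S Q :: 'f::field comp_space)"
    and "q \<notin> S \<Longrightarrow> split_word S (q # Q) = - ((split_word S Q :: 'f comp_space) * basis [q])"
proof -
  have R: "((-1) ^ n * basis R) * basis [q] = ((-1) ^ n * basis (R @ [q]) :: 'f comp_space)" for n R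
    by (simp add: mult.assoc basis_mult)
  show "split_word (insert q S) (q # Q) = basis [q] * (split_word S Q :: 'f comp_space)"
    by (simp add: split_word_def filter_insert_notin[OF assms] sign_basis_Cons del: insert_iff)
      (simp add: sign_basis_Cons)
  show "split_word S (q # Q) = - ((split_word S Q :: 'f comp_space) * basis [q])" if "q \<notin> S"
    using that by (simp add: split_word_def R)
qed

text \<open>
  Bracketing with one more entry on the left puts that entry in front, or at the very end with a
  sign; these are the terms with \<open>q \<in> S\<close> and \<open>q \<notin> S\<close> respectively.  The last entry is never moved by
  a bracket, so its membership in \<open>S\<close> is fixed.
\<close>

lemma dynkin_basis_eq_sum:
  assumes "Q @ [z] \<in> set_comps A"
  shows "dynkin_basis (Q @ [z]) =
    (\<Sum>S\<in>Pow (set Q). split_word (insert z S) (Q @ [z]) :: 'f::field comp_space)"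
  using assms
proof (induction Q arbitrary: A)
  case Nil
  show ?case by (simp add: split_word_def)
next
  case (Cons q Q)
  let ?D = "\<Sum>S\<in>Pow (set Q). split_word (insert z S) (Q @ [z]) :: 'f comp_space"
  have comps: "Q @ [z] \<in> set_comps (A - q)" and q: "q \<noteq> {}" "q \<subseteq> A"
    using Cons.prems by (auto simp: set_comps_Cons_iff)
  have nq: "q \<notin> set (Q @ [z])" "z \<notin> set Q"
    using Cons.prems by (auto simp: set_comps_iff)
  have D: "supp_on (A - q) ?D"
    by (intro supp_on_sum supp_on_split_word comps)
  have bq: "supp_on q (basis [q])"
    using q by (intro supp_on_basis) (simp add: set_comps_Cons_iff set_comps_empty)
  obtain C R where CR: "Q @ [z] = C # R" by (cases "Q @ [z]") auto
  have "dynkin_basis (q # Q @ [z]) = bracket (basis [q]) ?D"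
    using Cons.IH[OF comps] by (simp add: CR)
  also have "\<dots> = basis [q] * ?D - ?D * basis [q]"
    using vee_eq_mult[OF bq D] vee_eq_mult[OF D bq] by (simp add: bracket_def Int_commute)
  also have "\<dots> = (\<Sum>S\<in>Pow (set Q). split_word (insert z S) (q # Q @ [z]) +
      split_word (insert z (insert q S)) (q # Q @ [z]))"
  proof -
    have "split_word (insert z S) (q # Q @ [z]) + split_word (insert z (insert q S)) (q # Q @ [z]) =
        basis [q] * split_word (insert z S) (Q @ [z]) - split_word (insert z S) (Q @ [z]) * (basis [q] :: 'f comp_space)"
      if "S \<subseteq> set Q" for S
    proof -
      have f: "q \<notin> insert z S" using nq that by auto
      show ?thesis
        unfolding insert_commute[of z q] split_word_Cons(1)[OF nq(1)] split_word_Cons(2)[OF nq(1) f]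
        by simp
    qed
    thus ?thesis by (simp add: sum_distrib_left sum_distrib_right sum_subtractf)
  qed
  also have "\<dots> = (\<Sum>S\<in>Pow (insert q (set Q)). split_word (insert z S) (q # Q @ [z]))"
    using nq by (subst sum_Pow_insert) auto
  finally show ?case by simp
qed

section \<open>Acting with inverse blocks and with primitive elements\<close>

lemma e_lin_split_word:
  assumes "finite A" "Q \<in> set_comps A"
  shows "lext e_comp (split_word S Q) = e_comp (filter (\<lambda>q. q \<in> S) Q) *
    ((-1) ^ length (filter (\<lambda>q. q \<notin> S) Q) * e_comp (rev (filter (\<lambda>q. q \<notin> S) Q)) :: 'f::field comp_space)"
proof -
  have sgn: "(-1) ^ n * (x * y) = x * ((-1) ^ n * y)" for n and x y :: "'f comp_space"
    by (induction n) auto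
  show ?thesis
    unfolding split_word_def lext_sign lext_basis
      e_comp_append[OF assms(1) set_comps_split_word[OF assms(2)]] sgn ..
qed

lemma block_subset_Union_iff:
  assumes "Q \<in> set_comps A" "S \<subseteq> set Q" "q \<in> set Q"
  shows "q \<subseteq> \<Union>S \<longleftrightarrow> q \<in> S" and "q \<subseteq> A - \<Union>S \<longleftrightarrow> q \<notin> S"
proof -
  have "q \<noteq> {}" "q \<subseteq> A" using assms by (auto simp: set_comps_iff)
  moreover have "q \<inter> r = {}" if "r \<in> S" "r \<noteq> q" for r
    using assms that by (metis disjnt_def pairwiseD set_comps_iff subsetD)
  ultimately show "q \<subseteq> \<Union>S \<longleftrightarrow> q \<in> S" "q \<subseteq> A - \<Union>S \<longleftrightarrow> q \<notin> S" by blast+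
qed

lemma blocks_in_Union:
  assumes "Q \<in> set_comps A" "S \<subseteq> set Q"
  shows "blocks_in Q (\<Union>S) = filter (\<lambda>q. q \<in> S) Q"
    and "blocks_in Q (A - \<Union>S) = filter (\<lambda>q. q \<notin> S) Q"
  by (rule filter_cong[OF refl], simp only: block_subset_Union_iff[OF assms])+

text \<open>
  The subsets \<open>U\<close> of \<open>A\<close> not cutting any block of \<open>Q\<close> are exactly the unions of blocks; all other
  \<open>U\<close> contribute zero by \<open>act_block_mult\<close>.
\<close>

lemma sum_union_of_blocks:
  assumes "finite A" "Q \<in> set_comps A"
  shows "(\<Sum>U\<in>Pow A. if \<forall>q\<in>set Q. q \<subseteq> U \<or> q \<subseteq> A - U then h U else 0) =
    (\<Sum>S\<in>Pow (set Q). h (\<Union>S))"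
proof -
  have cover: "\<Union>(set Q) = A" using assms(2) by (simp add: set_comps_iff)
  have "(\<Sum>U\<in>Pow A. if \<forall>q\<in>set Q. q \<subseteq> U \<or> q \<subseteq> A - U then h U else 0) =
      (\<Sum>U\<in>{U \<in> Pow A. \<forall>q\<in>set Q. q \<subseteq> U \<or> q \<subseteq> A - U}. h U)"
    using assms(1) by (intro sum.inter_filter[symmetric]) simp
  also have "\<dots> = (\<Sum>S\<in>Pow (set Q). h (\<Union>S))"
  proof (rule sum.reindex_bij_witness[where i = Union and j = "\<lambda>U. {q \<in> set Q. q \<subseteq> U}"])
    fix U assume U: "U \<in> {U \<in> Pow A. \<forall>q\<in>set Q. q \<subseteq> U \<or> q \<subseteq> A - U}"
    show "\<Union>{q \<in> set Q. q \<subseteq> U} = U"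
    proof (intro equalityI subsetI)
      fix x assume x: "x \<in> U"
      then obtain q where "q \<in> set Q" "x \<in> q" using U cover by blast
      thus "x \<in> \<Union>{q \<in> set Q. q \<subseteq> U}" using x U by blast
    qed auto
    thus "h (\<Union>{q \<in> set Q. q \<subseteq> U}) = h U" by simp
    show "{q \<in> set Q. q \<subseteq> U} \<in> Pow (set Q)" by auto
  next
    fix S assume S: "S \<in> Pow (set Q)"
    show "\<Union>S \<in> {U \<in> Pow A. \<forall>q\<in>set Q. q \<subseteq> U \<or> q \<subseteq> A - U}"
      using S cover block_subset_Union_iff[OF assms(2)] by auto
    show "{q \<in> set Q. q \<subseteq> \<Union>S} = S"
      using S block_subset_Union_iff(1)[OF assms(2)] by auto
  qed
  finally show ?thesis .
qed

text \<open>
  By induction on \<open>A\<close>, both sides satisfy the recursion for \<open>inv_block A\<close>: the left side by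
  \<open>block_inverse\<close>, the right side because the sum of all \<open>split_word S Q\<close> is zero and \<open>S = {}\<close>
  contributes the reversal of \<open>Q\<close>.
\<close>

lemma act_inv_block:
  assumes "finite A" "Q \<in> set_comps A"
  shows "act (inv_block A) (e_comp Q) = ((-1) ^ length Q * e_comp (rev Q) :: 'f::field comp_space)"
  using assms
proof (induction A arbitrary: Q rule: finite_psubset_induct)
  case (psubset A)
  show ?case
  proof (cases "A = {}")
    case True
    thus ?thesis using psubset.prems by (simp add: set_comps_empty act_one)
  next
    case False
    let ?r = "\<lambda>R. (-1) ^ length R * e_comp (rev R) :: 'f comp_space"
    let ?t = "\<lambda>U. if \<forall>q\<in>set Q. q \<subseteq> U \<or> q \<subseteq> A - U
      then e_comp (blocks_in Q U) * ?r (blocks_in Q (A - U)) else 0"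
    have ne: "Q \<noteq> []" using False psubset.prems by (auto simp: set_comps_iff)
    obtain Q' z where Q: "Q = Q' @ [z]" using ne by (cases Q rule: rev_cases) auto
    \<comment> \<open>The full sum over \<open>U\<close> is the image of the sum of all \<open>split_word S Q\<close>, hence zero.\<close>
    have "(\<Sum>U\<in>Pow A. ?t U) = (\<Sum>S\<in>Pow (set Q). lext e_comp (split_word S Q))"
      using psubset.prems psubset.hyps
      by (simp add: sum_union_of_blocks blocks_in_Union e_lin_split_word)
    also have "\<dots> = lext e_comp (\<Sum>S\<in>Pow (set Q). if True then split_word S Q else 0)"
      by (simp add: lext_sum)
    also have "\<dots> = 0"
      unfolding Q using psubset.prems by (subst sum_split_word_cancel) (auto simp: Q set_comps_iff)
    finally have "?t {} + (\<Sum>U\<in>Pow A - {{}}. ?t U) = 0"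
      using psubset.hyps by (simp add: sum.remove[of "Pow A" "{}"])
    moreover have "?t {} = ?r Q"
    proof -
      have "q \<subseteq> A" "\<not> q \<subseteq> {}" if "q \<in> set Q" for q using that psubset.prems by (auto simp: set_comps_iff)
      hence "blocks_in Q {} = []" "blocks_in Q (A - {}) = Q" by (auto simp: filter_empty_conv)
      thus ?thesis using \<open>\<And>q. q \<in> set Q \<Longrightarrow> q \<subseteq> A\<close> by simp
    qed
    ultimately have 1: "?r Q + (\<Sum>U\<in>Pow A - {{}}. ?t U) = 0" by simp
    have t: "act (block U * inv_block (A - U)) (e_comp Q) = ?t U" if U: "U \<in> Pow A - {{}}" for U
    proof (cases "\<forall>q\<in>set Q. q \<subseteq> U \<or> q \<subseteq> A - U")
      case True
      have "Q \<in> set_comps ((A - U) \<union> U)" using U psubset.prems by (simp add: Un_absorb2)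
      hence "blocks_in Q (A - U) \<in> set_comps (A - U)"
        using True by (intro set_comps_blocks_in[where Y = U]) auto
      moreover have "A - U \<subset> A" using U by auto
      ultimately have "act (inv_block (A - U)) (e_comp (blocks_in Q (A - U))) = ?r (blocks_in Q (A - U))"
        using psubset.IH by blast
      thus ?thesis
        using U True psubset.prems psubset.hyps by (auto simp: act_block_mult supp_on_inv_block)
    next
      case F: False
      show ?thesis
        using U psubset.prems psubset.hyps by (subst act_block_mult) (auto simp: F supp_on_inv_block simp del: subset_Diff_insert)
    qed
    have "act (inv_block A) (e_comp Q) + (\<Sum>U\<in>Pow A - {{}}. ?t U) =
        (\<Sum>U\<in>Pow A. act (block U * inv_block (A - U)) (e_comp Q))"
      using psubset.hyps t by (simp add: sum.remove[of "Pow A" "{}"] block_def[of "{}"])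
    also have "\<dots> = 0"
      using psubset.hyps False by (simp add: block_inverse flip: act_sum)
    finally have 2: "act (inv_block A) (e_comp Q) + (\<Sum>U\<in>Pow A - {{}}. ?t U) = 0" .
    show ?thesis by (rule add_right_imp_eq[OF trans[OF 2 1[symmetric]]])
  qed
qed

text \<open>
  Here the sum over \<open>S\<close> is restricted by \<open>Min A \<in> \<Union>S\<close>.  If the block of \<open>Min A\<close> is not the last one, then the
  last block can still be moved in and out of \<open>S\<close> and everything cancels; if it is the last one,
  the sum is the Dynkin expansion.
\<close>

lemma act_e_block:
  assumes "finite A" "A \<noteq> {}" "Q \<in> set_comps A"
  shows "act (e_block A) (e_comp Q) =
    (if Q \<in> dagger_comps A then lext e_comp (dynkin_basis Q) else 0 :: 'f::field comp_space)"
proof -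
  let ?r = "\<lambda>R. (-1) ^ length R * e_comp (rev R) :: 'f comp_space"
  have "Q \<noteq> []" using assms by (auto simp: set_comps_iff)
  then obtain Q' z where Q: "Q = Q' @ [z]" by (cases Q rule: rev_cases) auto
  have z: "z \<notin> set Q'" "distinct (Q' @ [z])" using assms(3) by (auto simp: Q set_comps_iff)
  have "act (e_block A) (e_comp Q) =
      (\<Sum>U\<in>Pow A. act (if Min A \<in> U then block U * inv_block (A - U) else 0) (e_comp Q))"
    by (simp add: e_block_eq[OF assms(1,2)] act_sum)
  also have "\<dots> = (\<Sum>U\<in>Pow A. if \<forall>q\<in>set Q. q \<subseteq> U \<or> q \<subseteq> A - U
      then (if Min A \<in> U then e_comp (blocks_in Q U) * ?r (blocks_in Q (A - U)) else 0) else 0)"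
  proof (intro sum.cong refl)
    fix U assume U: "U \<in> Pow A"
    have "Q \<in> set_comps ((A - U) \<union> U)" using U assms by (simp add: Un_absorb2)
    hence "act (inv_block (A - U)) (e_comp (blocks_in Q (A - U))) = ?r (blocks_in Q (A - U))"
      if "\<forall>q\<in>set Q. q \<subseteq> U \<or> q \<subseteq> A - U"
      using that assms(1) by (intro act_inv_block set_comps_blocks_in[where Y = U]) auto
    thus "act (if Min A \<in> U then block U * inv_block (A - U) else 0) (e_comp Q) =
        (if \<forall>q\<in>set Q. q \<subseteq> U \<or> q \<subseteq> A - U
      then (if Min A \<in> U then e_comp (blocks_in Q U) * ?r (blocks_in Q (A - U)) else 0) else 0)"
      using U assms by (auto simp: act_block_mult supp_on_inv_block)
  qed
  also have "\<dots> = (\<Sum>S\<in>Pow (set Q). if Min A \<in> \<Union>S then lext e_comp (split_word S Q) else 0)"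
    unfolding sum_union_of_blocks[OF assms(1,3)]
  proof (intro sum.cong refl)
    fix S assume "S \<in> Pow (set Q)"
    thus "(if Min A \<in> \<Union>S then e_comp (blocks_in Q (\<Union>S)) * ?r (blocks_in Q (A - \<Union>S)) else 0) =
        (if Min A \<in> \<Union>S then lext e_comp (split_word S Q) else 0)"
      using assms by (cases "Min A \<in> \<Union>S") (simp_all add: blocks_in_Union e_lin_split_word)
  qed
  also have "\<dots> = lext e_comp (\<Sum>S\<in>Pow (set Q). if Min A \<in> \<Union>S then split_word S Q else 0)"
    unfolding lext_sum by (intro sum.cong) auto
  also have "(\<Sum>S\<in>Pow (set Q). if Min A \<in> \<Union>S then split_word S Q else 0 :: 'f comp_space) =
      (if Q \<in> dagger_comps A then dynkin_basis Q else 0)"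
  proof (cases "Min A \<in> z")
    case True
    have "Min A \<in> \<Union>S \<longleftrightarrow> z \<in> S" if "S \<subseteq> set Q" for S
    proof
      assume "Min A \<in> \<Union>S"
      then obtain q where q: "q \<in> S" "Min A \<in> q" by blast
      hence "q = z" using True that set_comps_block_unique[OF assms(3), of q z "Min A"] by (auto simp: Q)
      thus "z \<in> S" using q by simp
    qed (use True in auto)
    hence "(\<Sum>S\<in>Pow (set Q). if Min A \<in> \<Union>S then split_word S Q else 0 :: 'f comp_space) =
        (\<Sum>S\<in>Pow (insert z (set Q')). if z \<in> S then split_word S Q else 0)"
      by (intro sum.cong) (auto simp: Q)
    also have "\<dots> = (\<Sum>S\<in>Pow (set Q'). split_word (insert z S) Q)"
      using z by (subst sum_Pow_insert) (auto intro!: sum.cong)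
    also have "\<dots> = dynkin_basis Q"
      using dynkin_basis_eq_sum[of Q' z A, where 'f = 'f] assms(3) by (simp add: Q)
    finally show ?thesis using True assms(3) by (simp add: dagger_comps_def Q)
  next
    case False
    hence "(\<Sum>S\<in>Pow (set Q). if Min A \<in> \<Union>S then split_word S Q else 0 :: 'f comp_space) = 0"
      unfolding Q by (intro sum_split_word_cancel z) auto
    thus ?thesis using False by (simp add: dagger_comps_def Q)
  qed
  finally show ?thesis by simp
qed

section \<open>The multiplication rule\<close>

text \<open>
  If the blocks of \<open>Q\<close> inside each \<open>p\<close> already fill \<open>p\<close>, there is no room for a block of \<open>Q\<close> that
  is cut by \<open>P\<close>.
\<close>

lemma dagger_blocks_in_imp_cover:
  assumes "P \<in> set_comps A" "Q \<in> set_comps A" "\<forall>p\<in>set P. blocks_in Q p \<in> dagger_comps p" "q \<in> set Q"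
  shows "\<exists>p\<in>set P. q \<subseteq> p"
proof -
  obtain x where x: "x \<in> q" using assms(2,4) by (metis equals0I set_comps_iff)
  hence "x \<in> \<Union>(set P)" using assms by (auto simp: set_comps_iff)
  then obtain p where p: "p \<in> set P" "x \<in> p" by blast
  hence "x \<in> \<Union>(set (blocks_in Q p))"
    using assms(3) by (simp add: dagger_comps_def set_comps_iff)
  then obtain q' where q': "q' \<in> set Q" "q' \<subseteq> p" "x \<in> q'" by auto
  hence "q' = q" using set_comps_block_unique[OF assms(2) _ assms(4)] x by blast
  thus ?thesis using p q' by blast
qed

text \<open>
  Primitivity of the factors of \<open>e_comp Q\<close> lets the first block of \<open>P\<close> be split off; it acts only on
  the blocks of \<open>Q\<close> inside it, and \<open>act_e_block\<close> evaluates that action.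
\<close>

lemma act_e_comp:
  assumes "finite A" "P \<in> set_comps A" "Q \<in> set_comps A"
  shows "act (e_comp P) (e_comp Q) =
    (if \<forall>p\<in>set P. blocks_in Q p \<in> dagger_comps p
     then prod_list (map (\<lambda>p. lext e_comp (dynkin_basis (blocks_in Q p))) P) else 0 :: 'f::field comp_space)"
  using assms
proof (induction P arbitrary: A Q)
  case Nil
  hence "Q = []" by (simp add: set_comps_iff[of "[]"] set_comps_empty)
  thus ?case by (simp add: act_one)
next
  case (Cons p P)
  have p: "p \<noteq> {}" "p \<subseteq> A" "finite p" and P: "P \<in> set_comps (A - p)"
    using Cons.prems by (auto simp: set_comps_Cons_iff intro: finite_subset)
  have Q: "Q \<in> set_comps (p \<union> (A - p))" using p Cons.prems(3) by (simp add: Un_absorb1)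
  have fin: "finite (A - p)" using Cons.prems(1) by simp
  have "e_comp (p # P) = e_block p * (e_comp P :: 'f comp_space)"
    using e_comp_eq_prod_list(1)[OF Cons.prems(1,2), where 'f = 'f]
      e_comp_eq_prod_list(1)[OF fin P, where 'f = 'f] by simp
  hence *: "act (e_comp (p # P)) (e_comp Q) =
      (if \<forall>q\<in>set Q. q \<subseteq> p \<or> q \<subseteq> A - p
       then act (e_block p) (e_comp (blocks_in Q p)) * act (e_comp P) (e_comp (blocks_in Q (A - p)))
       else 0 :: 'f comp_space)"
    using act_mult[OF p(3) fin _ Q supp_on_e_block[OF p(3,1)] e_comp_eq_prod_list(2)[OF fin P]] by simp
  show ?case
  proof (cases "\<forall>q\<in>set Q. q \<subseteq> p \<or> q \<subseteq> A - p")
    case True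
    have Qp: "blocks_in Q p \<in> set_comps p" "blocks_in Q (A - p) \<in> set_comps (A - p)"
      using set_comps_blocks_in[of Q p "A - p"] set_comps_blocks_in[of Q "A - p" p] Q True
      by (auto simp: Un_commute)
    have sub: "blocks_in (blocks_in Q (A - p)) p' = blocks_in Q p'" if "p' \<in> set P" for p'
    proof -
      have "p' \<subseteq> A - p" using P that by (auto simp: set_comps_iff)
      thus ?thesis by (auto intro!: filter_cong)
    qed
    have "act (e_comp P) (e_comp (blocks_in Q (A - p))) =
        (if \<forall>p'\<in>set P. blocks_in Q p' \<in> dagger_comps p'
         then prod_list (map (\<lambda>p'. lext e_comp (dynkin_basis (blocks_in Q p'))) P) else 0 :: 'f comp_space)"
      unfolding Cons.IH[OF fin P Qp(2)] using sub
      by (simp del: filter_filter cong: map_cong ball_cong)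
    thus ?thesis
      using True act_e_block[OF p(3,1) Qp(1), where 'f = 'f] by (auto simp: *)
  next
    case False
    then obtain q where q: "q \<in> set Q" "\<not> q \<subseteq> p" "\<not> q \<subseteq> A - p" by blast
    have "\<not> (\<forall>p'\<in>set (p # P). blocks_in Q p' \<in> dagger_comps p')"
    proof
      assume "\<forall>p'\<in>set (p # P). blocks_in Q p' \<in> dagger_comps p'"
      then obtain p' where "p' \<in> set (p # P)" "q \<subseteq> p'"
        using dagger_blocks_in_imp_cover[OF Cons.prems(2,3)] q(1) by blast
      thus False using q(2,3) P by (auto simp: set_comps_iff)
    qed
    thus ?thesis unfolding * by (simp only: False if_False)
  qed
qed

lemma supp_on_e_lin_dynkin_basis:
  assumes "finite A" "A \<noteq> {}" "Q \<in> set_comps A"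
  shows "supp_on A (lext e_comp (dynkin_basis Q) :: 'f::field comp_space)"
proof -
  have "Q \<noteq> []" using assms by (auto simp: set_comps_iff)
  then obtain Q' z where Q: "Q = Q' @ [z]" by (cases Q rule: rev_cases) auto
  have "supp_on A (lext e_comp (split_word S Q) :: 'f comp_space)" for S
    unfolding split_word_def lext_sign lext_basis
    using e_comp_eq_prod_list(2)[OF assms(1) set_comps_split_word[OF assms(3)]] by (rule supp_on_sign)
  thus ?thesis
    using assms(3) unfolding Q by (subst dynkin_basis_eq_sum) (auto simp: lext_sum intro: supp_on_sum)
qed

text \<open>
  The index sets in a witness are forced, so the relation \<open>Q \<preceq>\<^sup>\<dagger> P\<close> reduces to a condition on the
  sublists of \<open>Q\<close> cut out by the blocks of \<open>P\<close>.
\<close>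

lemma dagger_witness_iff:
  assumes "P \<in> set_comps A" "Q \<in> set_comps A"
  shows "dagger_witness Q P Is \<longleftrightarrow>
    Is = map (\<lambda>p. {i. i < length Q \<and> Q ! i \<subseteq> p}) P \<and> (\<forall>p\<in>set P. blocks_in Q p \<in> dagger_comps p)"
proof -
  let ?I = "\<lambda>p. {i. i < length Q \<and> Q ! i \<subseteq> p}"
  have nths: "nths Q (?I p) = blocks_in Q p" for p
    by (simp add: filter_eq_nths)
  show ?thesis
  proof (intro iffI conjI)
    assume w: "dagger_witness Q P Is"
    show Is: "Is = map ?I P"
      using w dagger_witness_nth[OF assms w] by (intro nth_equalityI) (auto simp: dagger_witness_def)
    show "\<forall>p\<in>set P. blocks_in Q p \<in> dagger_comps p"
      using w by (auto simp: dagger_witness_def Is nths in_set_conv_nth)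
  next
    assume "Is = map ?I P \<and> (\<forall>p\<in>set P. blocks_in Q p \<in> dagger_comps p)"
    hence Is: "Is = map ?I P" and d: "\<forall>p\<in>set P. blocks_in Q p \<in> dagger_comps p" by auto
    have ne: "?I p \<noteq> {}" if "p \<in> set P" for p
    proof
      assume "?I p = {}"
      hence "blocks_in Q p = []" by (auto simp: filter_empty_conv in_set_conv_nth)
      moreover have "\<Union>(set (blocks_in Q p)) = p" using d that by (simp add: dagger_comps_def set_comps_iff)
      ultimately have "p = {}" by simp
      thus False using that assms(1) by (auto simp: set_comps_iff)
    qed
    have disj: "?I p \<inter> ?I p' = {}" if "p \<in> set P" "p' \<in> set P" "p \<noteq> p'" for p p'
    proof -
      have "p \<inter> p' = {}" using that assms(1) by (auto simp: set_comps_iff pairwise_def disjnt_def)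
      moreover have "Q ! i \<noteq> {}" if "i < length Q" for i
        using that assms(2) by (metis nth_mem set_comps_iff)
      ultimately show ?thesis by blast
    qed
    have "\<Union>(set Is) = {..<length Q}"
    proof -
      have "\<exists>p\<in>set P. Q ! i \<subseteq> p" if "i < length Q" for i
        using dagger_blocks_in_imp_cover[OF assms d] that by simp
      thus ?thesis by (auto simp: Is)
    qed
    moreover have "distinct Is"
    proof -
      have "distinct P" using assms(1) by (simp add: set_comps_iff)
      moreover have "inj_on ?I (set P)" using ne disj by (metis (no_types, lifting) inf.idem inj_onI)
      ultimately show ?thesis by (simp add: Is distinct_map)
    qed
    moreover have "pairwise disjnt (set Is)"
    proof (rule pairwiseI)
      fix I J assume IJ: "I \<in> set Is" "J \<in> set Is" "I \<noteq> J"
      obtain p where p: "p \<in> set P" "I = ?I p" using IJ(1) by (auto simp: Is)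
      obtain p' where p': "p' \<in> set P" "J = ?I p'" using IJ(2) by (auto simp: Is)
      have "p \<noteq> p'" using IJ(3) p(2) p'(2) by blast
      thus "disjnt I J" unfolding p(2) p'(2) disjnt_def by (rule disj[OF p(1) p'(1)])
    qed
    moreover have "{} \<notin> set Is" using ne by (auto simp: Is)
    ultimately have "Is \<in> set_comps {..<length Q}" by (simp add: set_comps_iff)
    thus "dagger_witness Q P Is"
      using d by (simp add: dagger_witness_def Is nths)
  qed
qed

theorem theorem6p2:
  fixes A :: "nat set" and P Q :: "nat set list"
  assumes "finite A" and "A \<noteq> {}" and "A \<subseteq> {1..}"
    and "P \<in> set_comps A" and "Q \<in> set_comps A"
  shows "(e_comp P :: 'f::field comp_space) \<curlywedge> e_comp Q =
           (if Q \<preceq>\<^sup>\<dagger> P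
            then vee_list (map (\<lambda>I. e_lin (dynkin (basis (nths Q I)))) (dagger_split Q P))
            else 0)
       \<and> (e_block A :: 'f comp_space) \<curlywedge> e_comp Q =
           (if Q \<in> dagger_comps A then e_lin (dynkin (basis Q)) else 0)"
proof
  let ?I = "\<lambda>p. {i. i < length Q \<and> Q ! i \<subseteq> p}"
  let ?F = "\<lambda>p. lext e_comp (dynkin_basis (blocks_in Q p)) :: 'f comp_space"
  have e_lin: "e_lin (dynkin (basis R)) = (lext e_comp (dynkin_basis R) :: 'f comp_space)" for R
    by (simp add: e_lin_def dynkin_def) (simp add: lin_ext_eq_lext)
  note supp = e_comp_eq_prod_list(2)[OF assms(1,4), where 'f = 'f] e_comp_eq_prod_list(2)[OF assms(1,5), where 'f = 'f]
  have P: "p \<noteq> {}" "finite p" if "p \<in> set P" for p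
    using that assms(1,4) by (auto simp: set_comps_iff intro: finite_subset)
  show "(e_comp P :: 'f comp_space) \<curlywedge> e_comp Q =
      (if Q \<preceq>\<^sup>\<dagger> P
       then vee_list (map (\<lambda>I. e_lin (dynkin (basis (nths Q I)))) (dagger_split Q P)) else 0)"
  proof (cases "\<forall>p\<in>set P. blocks_in Q p \<in> dagger_comps p")
    case True
    hence w: "dagger_witness Q P (map ?I P)"
      using dagger_witness_iff[OF assms(4,5)] by blast
    have "vee_list (map (\<lambda>I. e_lin (dynkin (basis (nths Q I)))) (dagger_split Q P)) = vee_list (map ?F P)"
      using dagger_split_eqI[OF assms(4,5) w] by (simp add: e_lin comp_def filter_eq_nths)
    also have "\<dots> = prod_list (map ?F P)"
    proof -
      have "supp_on p (?F p)" if "p \<in> set P" for p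
        using True that P[OF that] by (intro supp_on_e_lin_dynkin_basis) (auto simp: dagger_comps_def)
      thus ?thesis using vee_list_eq_prod_list[OF assms(4), of ?F] by simp
    qed
    also have "\<dots> = e_comp P \<curlywedge> e_comp Q"
      using True wedge_eq_act[OF supp] act_e_comp[OF assms(1,4,5), where 'f = 'f] by simp
    finally show ?thesis using w by (auto simp: dagger_le_def)
  next
    case False
    hence "\<not> Q \<preceq>\<^sup>\<dagger> P"
      using dagger_witness_iff[OF assms(4,5)] by (auto simp: dagger_le_def)
    moreover have "e_comp P \<curlywedge> e_comp Q = (0 :: 'f comp_space)"
      using act_e_comp[OF assms(1,4,5), where 'f = 'f] unfolding wedge_eq_act[OF supp]
      by (simp only: False if_False)
    ultimately show ?thesis by simp
  qed
  show "(e_block A :: 'f comp_space) \<curlywedge> e_comp Q =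
      (if Q \<in> dagger_comps A then e_lin (dynkin (basis Q)) else 0)"
    using wedge_eq_act[OF supp_on_e_block[OF assms(1,2)] supp(2)] act_e_block[OF assms(1,2,5), where 'f = 'f]
    by (simp add: e_lin)
qed

end
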